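(* If $C_1\colon y^2=f_1(x)$ and $C_2\colon y^2=f_2(x)$ are hyperelliptic curves over $K$ that are isomorphic over $K$, then their cluster pictures are equivalent.
   Context: $K$ is a non-archimedean local field with finite residue field of odd characteristic and valuation $v$ on $\bar K$ normalised on $K$. A hyperelliptic curve $y^2=f(x)$ has $f\in K[x]$ separable of degree $2g+1$ or $2g+2$, $g\ge2$; its cluster picture $(\Sigma,\mathcal R,d)$ has $\mathcal R$ the set of roots of $f$, $\Sigma$ the set of non-empty subsets $D\cap\mathcal R$ for discs $D=\{x\in\bar K:v(x-z)\ge d\}$, and depth $d_{\mathfrak s}=\min_{r,r'\in\mathfrak s}v(r-r')$ for $|\mathfrak s|>1$. Abstractly, a cluster picture $(\Sigma,\mathcal R,d)$ is a finite set $\mathcal R$ with a collection $\Sigma$ of non-empty subsets containing all singletons and $\mathcal R$, pairwise disjoint or nested, and depths $d_{\mathfrak s}\in\mathbb Q$ for $|\mathfrak s|>1$ with $d_{\mathfrak t}>d_{\mathfrak s}$ for $\mathfrak t\subsetneq\mathfrak s$; children, parent $P$ and relative depth $\delta_{\mathfrak s}=d_{\mathfrak s}-d_{P(\mathfrak s)}$ as usual. Isomorphism: bijection of the underlying sets inducing a bijection of clusters and preserving depths. Two cluster pictures are equivalent if one is isomorphic to a picture obtained from the other by finitely many of the following steps: (a) increase the depth of all proper clusters by some $m\in\mathbb Q$; (b) if $|\mathcal R|$ is odd, add a root: $\mathcal R'=\mathcal R\cup\{r\}$, $\Sigma'=\Sigma\cup\{\{r\},\mathcal R'\}\setminus\{\mathcal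 R\}$, other depths unchanged, $d'_{\mathcal R'}=d_{\mathcal R}$; (c) if $|\mathcal R|$ is even, $\{r\}$ is a child of $\mathcal R$ and $\mathcal R\setminus\{r\}\notin\Sigma$, remove $r$: $\mathcal R'=\mathcal R\setminus\{r\}$, $\Sigma'=\Sigma\cup\{\mathcal R'\}\setminus\{\mathcal R,\{r\}\}$, other depths unchanged, $d'_{\mathcal R'}=d_{\mathcal R}$; (d) if $|\mathcal R|$ is even, $\mathfrak s$ is a child of $\mathcal R$, $\mathfrak s^c=\mathcal R\setminus\mathfrak s$, and $-\delta_{\mathfrak s}\le m\le\delta_{\mathfrak s^c}$ (with $\delta_{\mathfrak s^c}=0$ if $\mathfrak s^c\notin\Sigma$, and depth $+\infty$ for singletons), redistribute: $\Sigma'=\Sigma\cup\{\mathfrak s,\mathfrak s^c\}$, $d'_{\mathcal R}=d_{\mathcal R}$, $d'_{\mathfrak t}=d_{\mathfrak t}+m$ for proper $\mathfrak t\subseteq\mathfrak s$ and $d'_{\mathfrak t}=d_{\mathfrak t}-m$ for proper $\mathfrak t\subseteq\mathfrak s^c$ (taking $d_{\mathfrak s^c}=d_{\mathcal R}$ if $\mathfrak s^c$ was not a cluster); finally remove $\mathfrak s$ (resp. $\mathfrak s^c$) from $\Sigma'$ if its new relative depth is $0$. *)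

theory Defs
  imports "HOL-Computational_Algebra.Computational_Algebra"
begin

text \<open>iota embeds K into its algebraic closure; v is the valuation on the algebraic
 closure (values on nonzero elements, v 0 is an unused junk value standing for +infinity).\<close>

definition field_embedding :: "('a::field \<Rightarrow> 'b::field) \<Rightarrow> bool" where
  "field_embedding \<iota> \<longleftrightarrow> inj \<iota> \<and> \<iota> 0 = 0 \<and> \<iota> 1 = 1 \<and>
     (\<forall>a b. \<iota> (a + b) = \<iota> a + \<iota> b) \<and> (\<forall>a b. \<iota> (a * b) = \<iota> a * \<iota> b)"

definition algebraic_closure_of :: "('a::field \<Rightarrow> 'b::field) \<Rightarrow> bool" where
  "algebraic_closure_of \<iota> \<longleftrightarrow> field_embedding \<iota> \<and>
     (\<forall>p::'b poly. degree p \<ge> 1 \<longrightarrow> (\<exists>z. poly p z = 0)) \<and>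
     (\<forall>z::'b. \<exists>p::'a poly. p \<noteq> 0 \<and> poly (map_poly \<iota> p) z = 0)"

definition is_valuation :: "('b::field \<Rightarrow> rat) \<Rightarrow> bool" where
  "is_valuation v \<longleftrightarrow>
     (\<forall>x y. x \<noteq> 0 \<longrightarrow> y \<noteq> 0 \<longrightarrow> v (x * y) = v x + v y) \<and>
     (\<forall>x y. x \<noteq> 0 \<longrightarrow> y \<noteq> 0 \<longrightarrow> x + y \<noteq> 0 \<longrightarrow> v (x + y) \<ge> min (v x) (v y))"

definition val_ring :: "('a::field \<Rightarrow> 'b::field) \<Rightarrow> ('b \<Rightarrow> rat) \<Rightarrow> 'a set" where
  "val_ring \<iota> v = {a. a = 0 \<or> v (\<iota> a) \<ge> 0}"

definition residue_rel :: "('a::field \<Rightarrow> 'b::field) \<Rightarrow> ('b \<Rightarrow> rat) \<Rightarrow> ('a \<times> 'a) set" where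
  "residue_rel \<iota> v = {(a, b). a \<in> val_ring \<iota> v \<and> b \<in> val_ring \<iota> v \<and>
                                (a - b = 0 \<or> v (\<iota> (a - b)) > 0)}"

definition complete_wrt :: "('a::field \<Rightarrow> 'b::field) \<Rightarrow> ('b \<Rightarrow> rat) \<Rightarrow> bool" where
  "complete_wrt \<iota> v \<longleftrightarrow>
     (\<forall>s::nat \<Rightarrow> 'a.
        (\<forall>N::rat. \<exists>M. \<forall>m\<ge>M. \<forall>n\<ge>M. s m - s n = 0 \<or> v (\<iota> (s m - s n)) \<ge> N) \<longrightarrow>
        (\<exists>L. \<forall>N::rat. \<exists>M. \<forall>n\<ge>M. s n - L = 0 \<or> v (\<iota> (s n - L)) \<ge> N))"

definition local_field_setup :: "('a::field \<Rightarrow> 'b::field) \<Rightarrow> ('b \<Rightarrow> rat) \<Rightarrow> bool" where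
  "local_field_setup \<iota> v \<longleftrightarrow>
     algebraic_closure_of \<iota> \<and> is_valuation v \<and>
     (\<lambda>a. v (\<iota> a)) ` (UNIV - {0}) = range of_int \<and>
     complete_wrt \<iota> v \<and>
     finite (val_ring \<iota> v // residue_rel \<iota> v) \<and>
     \<comment> \<open>residue characteristic is not 2: the image of 2 is nonzero in the residue field\<close>
     (2::'a) \<noteq> 0 \<and> v (\<iota> 2) = 0"

definition separable_poly :: "('a::field \<Rightarrow> 'b::field) \<Rightarrow> 'a poly \<Rightarrow> bool" where
  "separable_poly \<iota> f \<longleftrightarrow> f \<noteq> 0 \<and>
     (\<forall>z. poly (map_poly \<iota> f) z = 0 \<longrightarrow> order z (map_poly \<iota> f) = 1)"

definition hyperelliptic_poly :: "('a::field \<Rightarrow> 'b::field) \<Rightarrow> 'a poly \<Rightarrow> bool" where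
  "hyperelliptic_poly \<iota> f \<longleftrightarrow> separable_poly \<iota> f \<and>
     (\<exists>g::nat. g \<ge> 2 \<and> (degree f = 2*g+1 \<or> degree f = 2*g+2))"

text \<open>Function field K(C) = K(x)[y]/(y^2 - f(x)) of C: y^2 = f(x); an element (r, s)
 stands for r + s*y with r, s in K(x) = 'a poly fract.\<close>
type_synonym 'a ffield = "'a poly fract \<times> 'a poly fract"

definition ff_add :: "'a::field ffield \<Rightarrow> 'a ffield \<Rightarrow> 'a ffield" where
  "ff_add a b = (fst a + fst b, snd a + snd b)"

definition ff_mult :: "'a::field poly \<Rightarrow> 'a ffield \<Rightarrow> 'a ffield \<Rightarrow> 'a ffield" where
  "ff_mult f a b = (fst a * fst b + snd a * snd b * Fract f 1, fst a * snd b + snd a * fst b)"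

definition ff_const :: "'a::field \<Rightarrow> 'a ffield" where
  "ff_const c = (Fract [:c:] 1, 0)"

text \<open>The (smooth projective) curves y^2 = f1(x), y^2 = f2(x) are isomorphic over K iff their
 function fields are K-isomorphic.\<close>
definition curves_iso_over_K :: "'a::field poly \<Rightarrow> 'a poly \<Rightarrow> bool" where
  "curves_iso_over_K f1 f2 \<longleftrightarrow>
     (\<exists>\<phi> :: 'a ffield \<Rightarrow> 'a ffield. bij \<phi> \<and>
        (\<forall>a b. \<phi> (ff_add a b) = ff_add (\<phi> a) (\<phi> b)) \<and>
        (\<forall>a b. \<phi> (ff_mult f1 a b) = ff_mult f2 (\<phi> a) (\<phi> b)) \<and>
        (\<forall>c. \<phi> (ff_const c) = ff_const c))"

text \<open>A cluster picture is a triple (R, Sigma, d); d is only meaningful on proper clusters.\<close>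
type_synonym 'c cpic = "'c set \<times> 'c set set \<times> ('c set \<Rightarrow> rat)"

definition proper :: "'c set \<Rightarrow> bool" where
  "proper s \<longleftrightarrow> card s > 1"

definition cluster_picture :: "'c cpic \<Rightarrow> bool" where
  "cluster_picture P \<longleftrightarrow> (case P of (R, S, d) \<Rightarrow>
     finite R \<and> R \<noteq> {} \<and> R \<in> S \<and> (\<forall>s\<in>S. s \<noteq> {} \<and> s \<subseteq> R) \<and>
     (\<forall>r\<in>R. {r} \<in> S) \<and>
     (\<forall>s\<in>S. \<forall>t\<in>S. s \<inter> t = {} \<or> s \<subseteq> t \<or> t \<subseteq> s) \<and>
     (\<forall>s\<in>S. \<forall>t\<in>S. proper t \<longrightarrow> t \<subset> s \<longrightarrow> d t > d s))"

definition is_child :: "'c set set \<Rightarrow> 'c set \<Rightarrow> 'c set \<Rightarrow> bool" where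
  "is_child S t s \<longleftrightarrow> t \<in> S \<and> s \<in> S \<and> t \<subset> s \<and> \<not> (\<exists>u\<in>S. t \<subset> u \<and> u \<subset> s)"

definition iso_cpic :: "'c cpic \<Rightarrow> 'c cpic \<Rightarrow> bool" where
  "iso_cpic P Q \<longleftrightarrow> (case P of (R, S, d) \<Rightarrow> case Q of (R', S', d') \<Rightarrow>
     (\<exists>\<phi>. bij_betw \<phi> R R' \<and> S' = (\<lambda>s. \<phi> ` s) ` S \<and>
          (\<forall>s\<in>S. proper s \<longrightarrow> d' (\<phi> ` s) = d s)))"

definition step_shift :: "'c cpic \<Rightarrow> 'c cpic \<Rightarrow> bool" where
  "step_shift P Q \<longleftrightarrow> (case P of (R, S, d) \<Rightarrow> case Q of (R', S', d') \<Rightarrow>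
     (\<exists>m::rat. R' = R \<and> S' = S \<and> (\<forall>t\<in>S. proper t \<longrightarrow> d' t = d t + m)))"

definition step_add :: "'c cpic \<Rightarrow> 'c cpic \<Rightarrow> bool" where
  "step_add P Q \<longleftrightarrow> (case P of (R, S, d) \<Rightarrow> case Q of (R', S', d') \<Rightarrow>
     odd (card R) \<and> (\<exists>r. r \<notin> R \<and> R' = insert r R \<and>
        S' = (S \<union> {{r}, R'}) - {R} \<and> d' R' = d R \<and>
        (\<forall>t\<in>S'. proper t \<longrightarrow> t \<noteq> R' \<longrightarrow> d' t = d t)))"

definition step_remove :: "'c cpic \<Rightarrow> 'c cpic \<Rightarrow> bool" where
  "step_remove P Q \<longleftrightarrow> (case P of (R, S, d) \<Rightarrow> case Q of (R', S', d') \<Rightarrow>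
     even (card R) \<and> (\<exists>r. is_child S {r} R \<and> R - {r} \<notin> S \<and> R' = R - {r} \<and>
        S' = (S \<union> {R'}) - {R, {r}} \<and> d' R' = d R \<and>
        (\<forall>t\<in>S'. proper t \<longrightarrow> t \<noteq> R' \<longrightarrow> d' t = d t)))"

definition step_redistribute :: "'c cpic \<Rightarrow> 'c cpic \<Rightarrow> bool" where
  "step_redistribute P Q \<longleftrightarrow> (case P of (R, S, d) \<Rightarrow> case Q of (R', S', d') \<Rightarrow>
     even (card R) \<and> R' = R \<and>
     (\<exists>s m::rat. is_child S s R \<and>
        (let sc = R - s;
             \<comment> \<open>relative depth of s^c, 0 if s^c not a cluster (singleton case: +infinity)\<close>
             dsc = (if sc \<in> S then d sc - d R else 0);
             dn = (\<lambda>t. if t \<subseteq> s then d t + m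
                       else if t \<subseteq> sc then (if t = sc \<and> sc \<notin> S then d R else d t) - m
                       else d t);
             S0 = S \<union> {s, sc}
         in (proper s \<longrightarrow> - (d s - d R) \<le> m) \<and>
            (proper sc \<longrightarrow> m \<le> dsc) \<and>
            S' = S0 - {t. t = s \<and> proper s \<and> dn s - d R = 0}
                    - {t. t = sc \<and> proper sc \<and> dn sc - d R = 0} \<and>
            d' R = d R \<and>
            (\<forall>t\<in>S'. proper t \<longrightarrow> t \<noteq> R \<longrightarrow> d' t = dn t))))"

definition cpic_step :: "'c cpic \<Rightarrow> 'c cpic \<Rightarrow> bool" where
  "cpic_step P Q \<longleftrightarrow> cluster_picture P \<and> cluster_picture Q \<and>
     (step_shift P Q \<or> step_add P Q \<or> step_remove P Q \<or> step_redistribute P Q)"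

definition equivalent_cpic :: "'c cpic \<Rightarrow> 'c cpic \<Rightarrow> bool" where
  "equivalent_cpic P Q \<longleftrightarrow>
     (\<exists>X. cpic_step\<^sup>*\<^sup>* P X \<and> iso_cpic X Q) \<or> (\<exists>X. cpic_step\<^sup>*\<^sup>* Q X \<and> iso_cpic X P)"

definition roots_of :: "('a::field \<Rightarrow> 'b::field) \<Rightarrow> 'a poly \<Rightarrow> 'b set" where
  "roots_of \<iota> f = {z. poly (map_poly \<iota> f) z = 0}"

definition disc :: "('b::field \<Rightarrow> rat) \<Rightarrow> 'b \<Rightarrow> rat \<Rightarrow> 'b set" where
  "disc v z d = {x. x = z \<or> v (x - z) \<ge> d}"

definition curve_cluster_picture ::
  "('a::field \<Rightarrow> 'b::field) \<Rightarrow> ('b \<Rightarrow> rat) \<Rightarrow> 'a poly \<Rightarrow> 'b cpic" where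
  "curve_cluster_picture \<iota> v f =
     (let R = roots_of \<iota> f in
      (R, {s. s \<noteq> {} \<and> (\<exists>z d. s = disc v z d \<inter> R)},
       \<lambda>s. Min {v (r - r') | r r'. r \<in> s \<and> r' \<in> s \<and> r \<noteq> r'}))"

end

theory Submission
  imports Defs
begin

text \<open>An isomorphism of function fields maps \<open>x\<close> to some \<open>u\<close>. If \<open>u\<close> were not in \<open>K(x)\<close>, then
  \<open>x\<close> and \<open>u\<close> would satisfy a primitive equation of bidegree at most \<open>(2, 2)\<close>, whose discriminant
  in \<open>u\<close> has degree at most \<open>4\<close> but equals \<open>f2\<close> up to squares, contradicting \<open>deg f2 \<ge> 5\<close>. So
  \<open>u\<close> generates \<open>K(x)\<close>, is linear fractional by the same degree argument, and the resulting Moebius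
  transformation matches the branch points of the two curves.

  A Moebius transformation changes the pairwise distances \<open>w p q = v (p - q)\<close> of the branch points to
  \<open>w p q - h p - h q\<close>. Such a change moves the point at infinity through the tree of the branch
  points, crossing finitely many edges, and each crossing is a redistribution followed by a shift. A branch point
  at infinity is traded for a finite one of minimal distance to all roots by adding or removing a root.\<close>

section \<open>Cluster pictures of weight functions\<close>

text \<open>Two obstacles shape the proof. Steps relate pictures over one and the same point type,
  and the intermediate pictures of a chain belong to no evident polynomial. So everything is phrased
  for weight functions on finite sets of labels: infinity becomes a fresh label, and each weight
  function yields a cluster picture, which settles the axioms for all intermediate pictures at once.
  Bidegree (2, 2) has this origin: the preimage of \<open>x\<close> is \<open>(P + S y)/Q\<close>, a
  root of a quadratic over \<open>K[x]\<close>; the isomorphism turns its coefficients into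
  polynomials in \<open>u\<close>, and the equation has degree 2 in \<open>x\<close>. The minimal
  polynomial of \<open>u\<close> over \<open>K(x)\<close> divides it, and Gauss' lemma hands the
  degree bound in \<open>x\<close> to the primitive factor. Genus at least 2 gives degree at least
  5, just above the discriminant bound 4. Degrees are compared over the algebraic closure, where
  coprimality is the absence of common roots and equality up to squares preserves the roots of odd
  order.\<close>

definition min_depth :: "('c \<Rightarrow> 'c \<Rightarrow> rat) \<Rightarrow> 'c set \<Rightarrow> rat" where
  "min_depth w s = Min {w r r' | r r'. r \<in> s \<and> r' \<in> s \<and> r \<noteq> r'}"

text \<open>For the valuation of differences the isolated sets are the traces of discs; in this form
  they yield a cluster picture for every weight function.\<close>

definition isolated_sets :: "'c set \<Rightarrow> ('c \<Rightarrow> 'c \<Rightarrow> rat) \<Rightarrow> 'c set set" where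
  "isolated_sets L w = {s. s \<noteq> {} \<and> s \<subseteq> L \<and>
     (\<forall>p\<in>s. \<forall>q\<in>s. \<forall>x\<in>L - s. p \<noteq> q \<longrightarrow> w p x < w p q)}"

definition weight_pic :: "'c set \<Rightarrow> ('c \<Rightarrow> 'c \<Rightarrow> rat) \<Rightarrow> 'c cpic" where
  "weight_pic L w = (L, isolated_sets L w, min_depth w)"

text \<open>Large weights mean close points, as for a valuation. The diagonal is left out because
  \<open>v 0\<close> is a junk value.\<close>

definition ultrametric_on :: "'c set \<Rightarrow> ('c \<Rightarrow> 'c \<Rightarrow> rat) \<Rightarrow> bool" where
  "ultrametric_on L w \<longleftrightarrow> (\<forall>p\<in>L. \<forall>q\<in>L. p \<noteq> q \<longrightarrow> w p q = w q p) \<and>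
     (\<forall>p\<in>L. \<forall>q\<in>L. \<forall>r\<in>L. p \<noteq> q \<longrightarrow> q \<noteq> r \<longrightarrow> p \<noteq> r \<longrightarrow> min (w p q) (w q r) \<le> w p r)"

section \<open>Minimal depths and isolated sets\<close>

lemma finite_weights:
  assumes "finite s"
  shows "finite {w r r' | r r'. r \<in> s \<and> r' \<in> s \<and> r \<noteq> r'}"
proof -
  have "{w r r' | r r'. r \<in> s \<and> r' \<in> s \<and> r \<noteq> r'} \<subseteq> (\<lambda>(r, r'). w r r') ` (s \<times> s)"
    by auto
  then show ?thesis
    using assms by (meson finite_SigmaI finite_imageI finite_subset)
qed

lemma min_depth_le:
  assumes "finite s" "p \<in> s" "q \<in> s" "p \<noteq> q"
  shows "min_depth w s \<le> w p q"
  unfolding min_depth_def using assms by (intro Min_le finite_weights) auto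

lemma proper_finite: "proper s \<Longrightarrow> finite s"
  unfolding proper_def by (rule card_ge_0_finite) simp

lemma min_depth_attained:
  assumes "proper s"
  obtains p q where "p \<in> s" "q \<in> s" "p \<noteq> q" "min_depth w s = w p q"
proof -
  have fin: "finite s" by (rule proper_finite[OF assms])
  obtain a b where "a \<in> s" "b \<in> s" "a \<noteq> b"
    using assms fin unfolding proper_def by (metis card_le_Suc0_iff_eq not_less One_nat_def)
  then have "{w r r' | r r'. r \<in> s \<and> r' \<in> s \<and> r \<noteq> r'} \<noteq> {}" by auto
  from Min_in[OF finite_weights[OF fin] this] show ?thesis
    using that unfolding min_depth_def by auto
qed

lemma properI:
  assumes "finite s" "p \<in> s" "q \<in> s" "p \<noteq> q"
  shows "proper s"
proof -
  have "card {p, q} \<le> card s" using assms by (intro card_mono) auto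
  then show ?thesis using assms unfolding proper_def by simp
qed

lemma min_depth_eqI:
  assumes "finite s" "\<And>p q. p \<in> s \<Longrightarrow> q \<in> s \<Longrightarrow> p \<noteq> q \<Longrightarrow> D \<le> w p q"
    and "p \<in> s" "q \<in> s" "p \<noteq> q" "w p q = D"
  shows "min_depth w s = D"
proof -
  obtain a b where "a \<in> s" "b \<in> s" "a \<noteq> b" "min_depth w s = w a b"
    using min_depth_attained[OF properI[OF assms(1,3,4,5)]] .
  then show ?thesis using assms min_depth_le[OF assms(1,3,4,5), of w] by fastforce
qed

lemma min_depth_add:
  assumes "proper s" "\<And>p q. p \<in> s \<Longrightarrow> q \<in> s \<Longrightarrow> p \<noteq> q \<Longrightarrow> w' p q = w p q + m"
  shows "min_depth w' s = min_depth w s + m"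
proof -
  obtain a b where ab: "a \<in> s" "b \<in> s" "a \<noteq> b" "min_depth w s = w a b"
    using min_depth_attained[OF assms(1)] .
  show ?thesis
    using assms ab min_depth_le[OF proper_finite[OF assms(1)], of _ _ w]
    by (intro min_depth_eqI[of s _ _ a b] proper_finite) fastforce+
qed

lemma isolated_setsD:
  assumes "s \<in> isolated_sets L w" "p \<in> s" "q \<in> s" "p \<noteq> q" "x \<in> L" "x \<notin> s"
  shows "w p x < w p q"
  using assms unfolding isolated_sets_def by auto

text \<open>If \<open>s\<close> and \<open>t\<close> cross, with \<open>z\<close> in both,
  \<open>x\<close> only in \<open>s\<close> and \<open>y\<close> only in \<open>t\<close>, isolation
  of \<open>s\<close> gives \<open>w z y < w z x\<close> and isolation of \<open>t\<close> the
  reverse. Depths are strict because a point of \<open>s\<close> outside \<open>t\<close> undercuts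
  the minimum attained inside \<open>t\<close>.\<close>

lemma cluster_picture_weight_pic:
  assumes "finite L" "L \<noteq> {}"
  shows "cluster_picture (weight_pic L w)"
proof -
  have nest: "s \<inter> t = {} \<or> s \<subseteq> t \<or> t \<subseteq> s"
    if s: "s \<in> isolated_sets L w" and t: "t \<in> isolated_sets L w" for s t
  proof (rule ccontr)
    assume "\<not> ?thesis"
    then obtain x y z where xyz: "x \<in> s" "x \<notin> t" "y \<in> t" "y \<notin> s" "z \<in> s" "z \<in> t" by auto
    moreover have "x \<in> L" "y \<in> L" using xyz s t unfolding isolated_sets_def by auto
    ultimately have "w z y < w z x" "w z x < w z y"
      using isolated_setsD[OF s, of z x y] isolated_setsD[OF t, of z y x] by auto
    then show False by simp
  qed
  have dep: "min_depth w s < min_depth w t"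
    if s: "s \<in> isolated_sets L w" and t: "t \<in> isolated_sets L w" "proper t" and sub: "t \<subset> s" for s t
  proof -
    obtain p q where pq: "p \<in> t" "q \<in> t" "p \<noteq> q" "min_depth w t = w p q"
      using min_depth_attained[OF t(2)] .
    obtain x where x: "x \<in> s" "x \<notin> t" using sub by auto
    have sL: "s \<subseteq> L" using s unfolding isolated_sets_def by auto
    have "min_depth w s \<le> w p x"
      using pq x sub sL assms by (intro min_depth_le) (auto intro: finite_subset)
    also have "\<dots> < w p q" using isolated_setsD[OF t(1) pq(1,2,3)] x sL by auto
    finally show ?thesis using pq by simp
  qed
  have "L \<in> isolated_sets L w" "\<forall>r\<in>L. {r} \<in> isolated_sets L w"
    "\<forall>s\<in>isolated_sets L w. s \<noteq> {} \<and> s \<subseteq> L"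
    using assms unfolding isolated_sets_def by auto
  then show ?thesis
    using assms nest dep unfolding cluster_picture_def weight_pic_def by auto
qed

section \<open>Realising shifts and redistributions by weight functions\<close>

lemma weight_pic_shift:
  assumes "finite L" "L \<noteq> {}"
    and "\<And>p q. p \<in> L \<Longrightarrow> q \<in> L \<Longrightarrow> p \<noteq> q \<Longrightarrow> w' p q = w p q + m"
  shows "cpic_step (weight_pic L w) (weight_pic L w')"
proof -
  have "w' p x < w' p q \<longleftrightarrow> w p x < w p q"
    if "s \<subseteq> L" "p \<in> s" "q \<in> s" "x \<in> L - s" "p \<noteq> q" for s p q x
    using that assms(3)[of p x] assms(3)[of p q] by (cases "p = x") (auto simp: subset_iff)
  then have "isolated_sets L w' = isolated_sets L w"
    unfolding isolated_sets_def by (intro Collect_cong conj_cong refl) blast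
  moreover have "min_depth w' t = min_depth w t + m" if "t \<in> isolated_sets L w" "proper t" for t
    using that assms(3) unfolding isolated_sets_def by (intro min_depth_add) auto
  ultimately have "step_shift (weight_pic L w) (weight_pic L w')"
    unfolding step_shift_def weight_pic_def by auto
  then show ?thesis
    using cluster_picture_weight_pic assms(1,2) unfolding cpic_step_def by blast
qed

text \<open>Infinity slides by \<mu> along the tree edge from \<open>L\<close> towards
  \<open>s\<close>: weights inside \<open>s\<close> drop, weights outside rise, and weights across
  the edge stay \<open>D\<close>. The slack \<mu> in \<open>ins\<close> makes \<open>s\<close> a
  cluster and the amount \<open>- \<mu>\<close> admissible.\<close>

lemma weight_pic_redistribute:
  assumes fin: "finite L" and ev: "even (card L)" and \<mu>: "\<mu> > 0"
    and s: "s \<subseteq> L" "s \<noteq> {}" "s \<noteq> L"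
    and mixed: "\<And>p q. p \<in> L \<Longrightarrow> q \<in> L \<Longrightarrow> (p \<in> s) \<noteq> (q \<in> s) \<Longrightarrow> w p q = D"
    and ins: "\<And>p q. p \<in> s \<Longrightarrow> q \<in> s \<Longrightarrow> p \<noteq> q \<Longrightarrow> D + \<mu> \<le> w p q"
    and outs: "\<And>p q. p \<in> L - s \<Longrightarrow> q \<in> L - s \<Longrightarrow> p \<noteq> q \<Longrightarrow> D \<le> w p q"
    and mixed': "\<And>p q. p \<in> L \<Longrightarrow> q \<in> L \<Longrightarrow> (p \<in> s) \<noteq> (q \<in> s) \<Longrightarrow> w' p q = D"
    and ins': "\<And>p q. p \<in> s \<Longrightarrow> q \<in> s \<Longrightarrow> p \<noteq> q \<Longrightarrow> w' p q = w p q - \<mu>"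
    and outs': "\<And>p q. p \<in> L - s \<Longrightarrow> q \<in> L - s \<Longrightarrow> p \<noteq> q \<Longrightarrow> w' p q = w p q + \<mu>"
  shows "cpic_step (weight_pic L w) (weight_pic L w')"
proof -
  let ?S = "isolated_sets L w" and ?S' = "isolated_sets L w'" and ?sc = "L - s"
  let ?d = "min_depth w" and ?d' = "min_depth w'"
  obtain a where a: "a \<in> s" using s by auto
  obtain b where b: "b \<in> ?sc" using s by auto
  have finS: "finite s" "finite ?sc" using fin s finite_subset by auto
  have mixB: "\<forall>p\<in>L. \<forall>q\<in>L. (p \<in> s) \<noteq> (q \<in> s) \<longrightarrow> w p q = D"
    "\<forall>p\<in>L. \<forall>q\<in>L. (p \<in> s) \<noteq> (q \<in> s) \<longrightarrow> w' p q = D"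
    using mixed mixed' by blast+
  \<comment> \<open>An isolated set meeting both sides misses no point: a missing \<open>x\<close>
    lies opposite to \<open>p\<close> or to \<open>q\<close>, at weight \<open>D\<close>, which is
    not below \<open>u p q = D\<close>. The weight \<open>u\<close> is kept general so that this
    serves both \<open>w\<close> and \<open>w'\<close>.\<close>
  have straddle: "t = L" if "t \<in> isolated_sets L u" "\<forall>p\<in>L. \<forall>q\<in>L. (p \<in> s) \<noteq> (q \<in> s) \<longrightarrow> u p q = D"
    "p \<in> t" "p \<in> s" "q \<in> t" "q \<notin> s" for t u p q
  proof (rule ccontr)
    have tL: "t \<subseteq> L" using that(1) unfolding isolated_sets_def by auto
    assume "t \<noteq> L"
    then obtain x where x: "x \<in> L" "x \<notin> t" using tL by auto
    show False
    proof (cases "x \<in> s")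
      case True
      then show False
        using isolated_setsD[OF that(1,5,3), of x] that(2) x tL that(3-6) by fastforce
    next
      case False
      then show False
        using isolated_setsD[OF that(1,3,5), of x] that(2) x tL that(3-6) by fastforce
    qed
  qed
  have LS: "L \<in> ?S" "L \<in> ?S'" using s unfolding isolated_sets_def by auto
  have sS: "s \<in> ?S"
    unfolding isolated_sets_def using s mixed ins \<mu> by (fastforce simp: subset_iff)
  have child: "is_child ?S s L"
    unfolding is_child_def
  proof (intro conjI notI sS LS)
    show "s \<subset> L" using s by auto
    assume "\<exists>u\<in>?S. s \<subset> u \<and> u \<subset> L"
    then obtain u q where "u \<in> ?S" "s \<subset> u" "u \<subset> L" "q \<in> u" "q \<notin> s" by auto
    then show False using straddle[OF _ mixB(1), of u a q] a by auto
  qed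
  have all: "D \<le> w p q" if "p \<in> L" "q \<in> L" "p \<noteq> q" for p q
    using that mixed[of p q] ins[of p q] outs[of p q] \<mu> by (cases "p \<in> s"; cases "q \<in> s") auto
  have all': "D \<le> w' p q" if "p \<in> L" "q \<in> L" "p \<noteq> q" for p q
    using that mixed'[of p q] ins[of p q] outs[of p q] ins'[of p q] outs'[of p q] \<mu>
    by (cases "p \<in> s"; cases "q \<in> s") auto
  have ab: "a \<in> L" "b \<in> L" "a \<noteq> b" "w a b = D" "w' a b = D"
    using a b s mixed[of a b] mixed'[of a b] by auto
  have dL: "?d L = D" by (rule min_depth_eqI[where w = w, OF fin all ab(1,2,3,4)])
  have dL': "?d' L = D" by (rule min_depth_eqI[where w = w', OF fin all' ab(1,2,3,5)])
  have ds: "D + \<mu> \<le> ?d s" if "proper s"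
    using min_depth_attained[OF that] ins by metis
  have dsc: "D \<le> ?d ?sc" if "proper ?sc"
    using min_depth_attained[OF that] outs by metis
  have scS': "?sc \<in> ?S'"
    unfolding isolated_sets_def
  proof (intro CollectI conjI ballI impI)
    fix p q x assume h: "p \<in> ?sc" "q \<in> ?sc" "x \<in> L - ?sc" "p \<noteq> q"
    then show "w' p x < w' p q"
      using mixed'[of p x] outs[of p q] outs'[of p q] \<mu> by auto
  qed (use b in auto)
  have sub_s: "t \<in> ?S \<longleftrightarrow> t \<in> ?S'" if t: "t \<subseteq> s" "t \<noteq> s" for t
  proof -
    \<comment> \<open>A point \<open>y\<close> of \<open>s\<close> outside \<open>t\<close> pushes
      the weights inside an isolated \<open>t\<close> strictly above \<open>D + \<mu>\<close>, so
      lowering them by \<mu> keeps \<open>t\<close> isolated from the points outside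
      \<open>s\<close>.\<close>
    obtain y where y: "y \<in> s" "y \<notin> t" using t by auto
    have "w p x < w p q" if "\<forall>p\<in>t. \<forall>q\<in>t. \<forall>x\<in>L - t. p \<noteq> q \<longrightarrow> w' p x < w' p q"
      "p \<in> t" "q \<in> t" "x \<in> L - t" "p \<noteq> q" for p q x
    proof (cases "x \<in> s")
      case True
      have "p \<in> s" "q \<in> s" "p \<noteq> x" using that(2-5) t by auto
      then show ?thesis using True that(1)[rule_format, OF that(2-5)] that(5) ins'[of p x] ins'[of p q] by simp
    next
      case False
      then show ?thesis using that(2-5) t s mixed[of p x] ins[of p q] \<mu> by (auto simp: subset_iff)
    qed
    moreover have "w' p x < w' p q" if "\<forall>p\<in>t. \<forall>q\<in>t. \<forall>x\<in>L - t. p \<noteq> q \<longrightarrow> w p x < w p q"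
      "p \<in> t" "q \<in> t" "x \<in> L - t" "p \<noteq> q" for p q x
    proof (cases "x \<in> s")
      case True
      have "p \<in> s" "q \<in> s" "p \<noteq> x" using that(2-5) t by auto
      then show ?thesis using True that(1)[rule_format, OF that(2-5)] that(5) ins'[of p x] ins'[of p q] by simp
    next
      case False
      have pL: "p \<in> L" "p \<in> s" "q \<in> s" "p \<noteq> y" "y \<in> L" using that t s y by auto
      have "w p y < w p q" using that(1)[rule_format, OF that(2,3) _ that(5), of y] y s by auto
      moreover have "D + \<mu> \<le> w p y" using ins[of p y] pL y by auto
      ultimately show ?thesis using that(2-5) False pL mixed'[of p x] ins'[of p q] by auto
    qed
    ultimately show ?thesis
      unfolding isolated_sets_def by blast
  qed
  have sub_sc: "t \<in> ?S \<longleftrightarrow> t \<in> ?S'" if t: "t \<subseteq> ?sc" "t \<noteq> ?sc" for t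
  proof -
    obtain y where y: "y \<in> ?sc" "y \<notin> t" using t by auto
    have "w p x < w p q" if "\<forall>p\<in>t. \<forall>q\<in>t. \<forall>x\<in>L - t. p \<noteq> q \<longrightarrow> w' p x < w' p q"
      "p \<in> t" "q \<in> t" "x \<in> L - t" "p \<noteq> q" for p q x
    proof (cases "x \<in> s")
      case False
      have "p \<in> ?sc" "q \<in> ?sc" "x \<in> ?sc" "p \<noteq> x" using False that(2-5) t by auto
      then show ?thesis using that(1)[rule_format, OF that(2-5)] that(5) outs'[of p x] outs'[of p q] by simp
    next
      case True
      have pL: "p \<in> ?sc" "q \<in> ?sc" "p \<noteq> y" using that t y by auto
      have "w' p y < w' p q" using that(1)[rule_format, OF that(2,3) _ that(5), of y] y by auto
      moreover have "D \<le> w p y" using outs[of p y] pL y by auto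
      ultimately show ?thesis
        using that(2-5) True pL y mixed[of p x] outs'[of p q] outs'[of p y] by auto
    qed
    moreover have "w' p x < w' p q" if "\<forall>p\<in>t. \<forall>q\<in>t. \<forall>x\<in>L - t. p \<noteq> q \<longrightarrow> w p x < w p q"
      "p \<in> t" "q \<in> t" "x \<in> L - t" "p \<noteq> q" for p q x
    proof (cases "x \<in> s")
      case False
      have "p \<in> ?sc" "q \<in> ?sc" "x \<in> ?sc" "p \<noteq> x" using False that(2-5) t by auto
      then show ?thesis using that(1)[rule_format, OF that(2-5)] that(5) outs'[of p x] outs'[of p q] by simp
    next
      case True
      have pL: "p \<in> ?sc" "q \<in> ?sc" using that t by auto
      then show ?thesis
        using that(2-5) True mixed'[of p x] outs'[of p q] outs[of p q] \<mu> by auto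
    qed
    ultimately show ?thesis
      unfolding isolated_sets_def by blast
  qed
  have s_in': "s \<in> ?S' \<longleftrightarrow> \<not> (proper s \<and> ?d s = D + \<mu>)"
  proof
    assume sS': "s \<in> ?S'"
    show "\<not> (proper s \<and> ?d s = D + \<mu>)"
    proof
      assume h: "proper s \<and> ?d s = D + \<mu>"
      obtain p q where pq: "p \<in> s" "q \<in> s" "p \<noteq> q" "?d s = w p q"
        using min_depth_attained[of s w] h by blast
      then show False
        using isolated_setsD[OF sS' pq(1,2,3), of b] b h mixed'[of p b] ins'[of p q] s by auto
    qed
  next
    assume h: "\<not> (proper s \<and> ?d s = D + \<mu>)"
    show "s \<in> ?S'"
      unfolding isolated_sets_def
    proof (intro CollectI conjI ballI impI)
      fix p q x assume g: "p \<in> s" "q \<in> s" "x \<in> L - s" "p \<noteq> q"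
      have "proper s" using properI[OF finS(1) g(1,2,4)] .
      then have "D + \<mu> < ?d s" using h ds by auto
      also have "\<dots> \<le> w p q" using min_depth_le[OF finS(1) g(1,2,4)] .
      finally show "w' p x < w' p q"
        using g s mixed'[of p x] ins'[of p q] by auto
    qed (use s in auto)
  qed
  have sc_ne: "\<not> ?sc \<subseteq> s" "?sc \<noteq> s" "?sc \<noteq> L" "\<not> L \<subseteq> s" using a b s by auto
  \<comment> \<open>The depths prescribed by the step for \<open>m = - \<mu>\<close>; the form
    \<open>+ - \<mu>\<close> matches the definition syntactically.\<close>
  let ?dn = "\<lambda>t. if t \<subseteq> s then ?d t + - \<mu>
                 else if t \<subseteq> ?sc then (if t = ?sc \<and> ?sc \<notin> ?S then ?d L else ?d t) - - \<mu> else ?d t"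
  \<comment> \<open>The complement rises by \<mu> > 0 from a depth of at least \<open>D\<close>, so
    it is never dropped; only \<open>s\<close> can end with relative depth 0.\<close>
  have no_sc: "{t. t = ?sc \<and> proper ?sc \<and> ?dn ?sc - ?d L = 0} = {}"
    using sc_ne dsc dL \<mu> by auto
  have rem_s: "{t. t = s \<and> proper s \<and> ?dn s - ?d L = 0} = {t. t = s \<and> proper s \<and> ?d s = D + \<mu>}"
    using dL by auto
  have S'eq: "?S' = ?S \<union> {s, ?sc} - {t. t = s \<and> proper s \<and> ?dn s - ?d L = 0}
      - {t. t = ?sc \<and> proper ?sc \<and> ?dn ?sc - ?d L = 0}"
    unfolding no_sc rem_s
  proof (intro set_eqI)
    fix t
    consider "t = s" | "t = ?sc" | "t \<subseteq> s" "t \<noteq> s" | "t \<subseteq> ?sc" "t \<noteq> ?sc" | "\<not> t \<subseteq> L"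
      | p q where "t \<subseteq> L" "p \<in> t" "p \<in> s" "q \<in> t" "q \<notin> s"
      by blast
    then show "t \<in> ?S' \<longleftrightarrow> t \<in> ?S \<union> {s, ?sc} - {t. t = s \<and> proper s \<and> ?d s = D + \<mu>} - {}"
    proof cases
      case 1
      then show ?thesis using s_in' by auto
    next
      case 2
      then show ?thesis using scS' sc_ne by auto
    next
      case 3
      then show ?thesis using sub_s sc_ne by auto
    next
      case 4
      then show ?thesis using sub_sc s_in' sc_ne sS a by auto
    next
      case 5
      then show ?thesis using s unfolding isolated_sets_def by auto
    next
      case 6
      then show ?thesis
        using straddle[OF _ mixB(1) 6(2-5)] straddle[OF _ mixB(2) 6(2-5)] LS by auto
    qed
  qed
  \<comment> \<open>If the complement is not a cluster, some pair in it is as far apart as the two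
    sides are. Its depth is then \<open>D\<close>, the value that the step assigns to it by
    convention.\<close>
  have sc_depth: "?d ?sc = D" if nS: "?sc \<notin> ?S" "proper ?sc"
  proof -
    obtain p q x where g: "p \<in> ?sc" "q \<in> ?sc" "x \<in> s" "p \<noteq> q" "\<not> w p x < w p q"
      using nS b unfolding isolated_sets_def by auto
    then have "w p q = D" using mixed[of p x] outs[of p q] s by auto
    then show ?thesis
      using g outs by (intro min_depth_eqI[OF finS(2), of D w p q]) auto
  qed
  have dep': "?d' t = ?dn t" if t: "t \<in> ?S'" "proper t" "t \<noteq> L" for t
  proof -
    have tL: "t \<subseteq> L" using t unfolding isolated_sets_def by auto
    consider "t \<subseteq> s" | "t \<subseteq> ?sc" "\<not> t \<subseteq> s"
      using straddle[OF t(1) mixB(2)] t(3) tL by blast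
    then show ?thesis
    proof cases
      case 1
      then show ?thesis using t ins' by (simp, subst min_depth_add[where w = w and m = "-\<mu>"]) auto
    next
      case 2
      have "?d' t = ?d t + \<mu>" using 2 t outs' by (intro min_depth_add) auto
      moreover have "?d t = ?d L" if "t = ?sc" "?sc \<notin> ?S"
        using that sc_depth t dL by auto
      ultimately show ?thesis using 2 by auto
    qed
  qed
  have "step_redistribute (weight_pic L w) (weight_pic L w')"
    unfolding step_redistribute_def weight_pic_def Let_def prod.case
  proof (intro conjI ev refl exI[of _ s] exI[of _ "-\<mu>"] child S'eq ballI impI)
    show "- (?d s - ?d L) \<le> - \<mu>" if "proper s" using ds that dL by auto
    show "- \<mu> \<le> (if ?sc \<in> ?S then ?d ?sc - ?d L else 0)" if "proper ?sc"
      using dsc that dL \<mu> by auto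
    show "?d' L = ?d L" using dL dL' by simp
    show "?d' t = ?dn t" if "t \<in> ?S'" "proper t" "t \<noteq> L" for t
      by (rule dep'[OF that])
  qed
  then show ?thesis
    using cluster_picture_weight_pic fin s unfolding cpic_step_def by blast
qed

text \<open>Here \<open>H p\<close> plays the role of the valuation of \<open>p - t\<close> for a new point \<open>t\<close>. Raising the
  truncation level from one value of \<open>H\<close> to the next moves infinity one edge towards \<open>t\<close>, which is
  one redistribution followed by a shift.\<close>

lemma weight_pic_truncate:
  fixes H :: "'c \<Rightarrow> rat"
  assumes fin: "finite L" and ev: "even (card L)"
    and sym: "\<And>p q. p \<in> L \<Longrightarrow> q \<in> L \<Longrightarrow> p \<noteq> q \<Longrightarrow> w p q = w q p"
    and ge: "\<And>p q. p \<in> L \<Longrightarrow> q \<in> L \<Longrightarrow> p \<noteq> q \<Longrightarrow> min (H p) (H q) \<le> w p q"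
    and eq: "\<And>p q. p \<in> L \<Longrightarrow> q \<in> L \<Longrightarrow> H p < H q \<Longrightarrow> w p q = H p"
    and a: "a \<in> H ` L"
  shows "cpic_step\<^sup>*\<^sup>* (weight_pic L w) (weight_pic L (\<lambda>p q. w p q - min (H p) a - min (H q) a))"
  using a
proof (induction "card {x \<in> H ` L. x < a}" arbitrary: a rule: less_induct)
  case less
  let ?below = "\<lambda>a. {x \<in> H ` L. x < a}"
  have ne: "L \<noteq> {}" using less.prems by auto
  have finb: "finite (?below a)" for a using fin by auto
  show ?case
  proof (cases "?below a = {}")
    \<comment> \<open>At the lowest level every truncated value equals \<open>a\<close>, so all
      weights change by the constant \<open>- 2 * a\<close>.\<close>
    case True
    then have "\<And>p. p \<in> L \<Longrightarrow> a \<le> H p" by (auto simp: not_less)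
    then show ?thesis
      by (intro r_into_rtranclp weight_pic_shift[where m = "- 2 * a"] fin ne) auto
  next
    case False
    define b where "b = Max (?below a)"
    have b: "b \<in> ?below a" unfolding b_def using Max_in[OF finb False] .
    have gap: "H p \<le> b \<or> a \<le> H p" if "p \<in> L" for p
      using Max_ge[OF finb, of "H p" a] that unfolding b_def by (auto simp: not_less not_le)
    have "?below b \<subset> ?below a" using b by auto
    then have "card (?below b) < card (?below a)" using finb psubset_card_mono by blast
    from less.hyps[OF this] b have IH: "cpic_step\<^sup>*\<^sup>* (weight_pic L w)
        (weight_pic L (\<lambda>p q. w p q - min (H p) b - min (H q) b))" by auto
    let ?w = "\<lambda>p q. w p q - min (H p) b - min (H q) b"
    let ?s = "{p \<in> L. a \<le> H p}"
    \<comment> \<open>The weights after redistribution; the shift by \<open>- (a - b)\<close> then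
      gives truncation at \<open>a\<close>. Points on different sides of \<open>?s\<close> have
      weight \<open>- b\<close> at level \<open>b\<close>, because there \<open>w p q\<close> is the
      smaller of \<open>H p\<close> and \<open>H q\<close>.\<close>
    let ?w' = "\<lambda>p q. if p \<in> ?s \<and> q \<in> ?s then ?w p q - (a - b)
                     else if p \<notin> ?s \<and> q \<notin> ?s then ?w p q + (a - b) else - b"
    have mixed: "?w p q = - b" if "p \<in> L" "q \<in> L" "(p \<in> ?s) \<noteq> (q \<in> ?s)" for p q
    proof -
      have *: "?w p q = - b" if "p \<in> L" "q \<in> L" "p \<notin> ?s" "q \<in> ?s" for p q
        using that gap[of p] gap[of q] eq[of p q] b by auto
      show ?thesis
        using that *[of p q] *[of q p] sym[of p q] by (cases "p \<in> ?s"; cases "p = q") auto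
    qed
    have step1: "cpic_step (weight_pic L ?w) (weight_pic L ?w')"
    proof (rule weight_pic_redistribute[where \<mu> = "a - b" and s = ?s and D = "- b"])
      show "?s \<noteq> {}" using less.prems by auto
      show "?s \<noteq> L" using b by (auto simp: not_le) (metis (no_types, lifting) mem_Collect_eq not_less)
      show "- b + (a - b) \<le> ?w p q" if "p \<in> ?s" "q \<in> ?s" "p \<noteq> q" for p q
        using that ge[of p q] b by auto
      show "- b \<le> ?w p q" if "p \<in> L - ?s" "q \<in> L - ?s" "p \<noteq> q" for p q
        using that ge[of p q] gap[of p] gap[of q] by (auto simp: min_def split: if_splits)
    qed (use fin ev b mixed in auto)
    have step2: "cpic_step (weight_pic L ?w') (weight_pic L (\<lambda>p q. w p q - min (H p) a - min (H q) a))"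
    proof (rule weight_pic_shift[where m = "- (a - b)", OF fin ne])
      fix p q assume pq: "p \<in> L" "q \<in> L" "p \<noteq> q"
      show "w p q - min (H p) a - min (H q) a = ?w' p q + - (a - b)"
        using pq mixed[of p q] gap[of p] gap[of q] b
        by (cases "p \<in> ?s"; cases "q \<in> ?s") (auto simp: min_def)
    qed
    show ?thesis using IH step1 step2 by (meson rtranclp.rtrancl_into_rtrancl)
  qed
qed

text \<open>Up to an additive constant, \<open>h\<close> is the distance to a point \<open>t\<close>, normalised by
  \<open>min h = min w\<close>.\<close>

lemma weight_pic_twist:
  fixes h :: "'c \<Rightarrow> rat"
  assumes fin: "finite L" and ev: "even (card L)" and pr: "proper L"
    and u: "ultrametric_on L w" and u': "ultrametric_on L w'"
    and tw: "\<And>p q. p \<in> L \<Longrightarrow> q \<in> L \<Longrightarrow> p \<noteq> q \<Longrightarrow> w' p q = w p q - h p - h q"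
  shows "cpic_step\<^sup>*\<^sup>* (weight_pic L w) (weight_pic L w')"
proof -
  have ne: "L \<noteq> {}" using pr unfolding proper_def by auto
  define D where "D = min_depth w L"
  have D: "D \<le> w p q" if "p \<in> L" "q \<in> L" "p \<noteq> q" for p q
    unfolding D_def using min_depth_le[OF fin that] .
  have sym: "w p q = w q p" if "p \<in> L" "q \<in> L" "p \<noteq> q" for p q
    using u that unfolding ultrametric_on_def by blast
  have tri: "min (w p q) (w q r) \<le> w p r"
    if "p \<in> L" "q \<in> L" "r \<in> L" "p \<noteq> q" "q \<noteq> r" "p \<noteq> r" for p q r
    using u that unfolding ultrametric_on_def by blast
  have tri': "min (w' p q) (w' q r) \<le> w' p r"
    if "p \<in> L" "q \<in> L" "r \<in> L" "p \<noteq> q" "q \<noteq> r" "p \<noteq> r" for p q r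
    using u' that unfolding ultrametric_on_def by blast
  have "Min (h ` L) \<in> h ` L" using fin ne by (intro Min_in) auto
  then obtain p0 where p0: "p0 \<in> L" "h p0 = Min (h ` L)" by auto
  have hmin: "h p0 \<le> h p" if "p \<in> L" for p using p0 fin that by simp
  \<comment> \<open>A point \<open>p\<close> with \<open>h p\<close> above the minimum is at the
    least weight \<open>D\<close> from each minimiser \<open>p1\<close>. Otherwise take
    \<open>q\<close> with \<open>w p q = D\<close>; then also \<open>w p1 q = D\<close>, so
    \<open>w' p q < w' p1 q\<close>. The ultrametric inequality forces
    \<open>w' p p1 \<le> w' p q\<close>, which untwists to \<open>h q < h p0\<close>.\<close>
  have far: "w p p1 = D" if p: "p \<in> L" "h p0 < h p" and p1: "p1 \<in> L" "h p1 = h p0" for p p1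
  proof (rule ccontr)
    assume "w p p1 \<noteq> D"
    have pp1: "p \<noteq> p1" using p p1 by auto
    then have gt: "D < w p p1" using D[of p p1] p p1 \<open>w p p1 \<noteq> D\<close> by auto
    obtain c d where cd: "c \<in> L" "d \<in> L" "c \<noteq> d" "w c d = D"
      using min_depth_attained[OF pr] unfolding D_def by metis
    have "\<exists>q\<in>L. q \<noteq> p \<and> w p q = D"
    proof (cases "p = c \<or> p = d")
      case True
      then show ?thesis using cd sym[of c d] by auto
    next
      case False
      then have "min (w c p) (w p d) \<le> D" using tri[of c p d] cd p by auto
      moreover have "D \<le> w c p" "D \<le> w p d" "w c p = w p c"
        using False cd p D[of c p] D[of p d] sym[of c p] by auto
      ultimately have "w p c = D \<or> w p d = D" by linarith
      then show ?thesis using False cd by auto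
    qed
    then obtain q where q: "q \<in> L" "q \<noteq> p" "w p q = D" by auto
    have qp1: "q \<noteq> p1" using q gt by auto
    have "min (w p p1) (w p1 q) \<le> D" using tri[of p p1 q] q p p1 pp1 qp1 by auto
    moreover have "D \<le> w p1 q" using D[of p1 q] q p1 qp1 by auto
    ultimately have "w p1 q = D" using gt by linarith
    then have "w' p q < w' p1 q" using tw[of p q] tw[of p1 q] p p1 q qp1 by auto
    moreover have "min (w' p p1) (w' p1 q) \<le> w' p q" using tri'[of p p1 q] p p1 q pp1 qp1 by auto
    ultimately have "w' p p1 \<le> w' p q" by auto
    then have "h q < h p0" using tw[of p p1] tw[of p q] p p1 q pp1 gt by auto
    then show False using hmin[OF q(1)] by auto
  qed
  note far0 = far[OF _ _ p0(1) refl]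
  define H where "H p = h p + D - h p0" for p
  have w'H: "w' p q = (w p q - H p - H q) + 2 * (D - h p0)" if "p \<in> L" "q \<in> L" "p \<noteq> q" for p q
    using tw[OF that] unfolding H_def by simp
  have near: "w p q = H p" if pq: "p \<in> L" "q \<in> L" "H p < H q" for p q
  proof (cases "h p = h p0")
    case True
    have "p \<noteq> q" using pq by auto
    then show ?thesis using True far[of q p] sym[of p q] pq unfolding H_def by auto
  next
    \<comment> \<open>For \<open>w'\<close> the triangle \<open>p\<close>, \<open>q\<close>,
      \<open>p0\<close> is isosceles: \<open>w' q p0 < w' p p0\<close> gives
      \<open>w' p q = w' q p0\<close>, and untwisting yields \<open>H p\<close>.\<close>
    case False
    then have hp: "h p0 < h p" "h p0 < h q" "h p < h q" "p \<noteq> q" "p \<noteq> p0" "q \<noteq> p0"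
      using hmin[OF pq(1)] pq unfolding H_def by auto
    have "w' p p0 = D - h p - h p0" "w' q p0 = D - h q - h p0"
      using far0[of p] far0[of q] tw[of p p0] tw[of q p0] hp pq p0(1) by auto
    moreover have "min (w' q p) (w' p p0) \<le> w' q p0"
      using tri'[of q p p0] pq p0(1) hp by auto
    moreover have "min (w' p p0) (w' p0 q) \<le> w' p q" "w' p0 q = w' q p0"
      using tri'[of p p0 q] u' pq p0(1) hp unfolding ultrametric_on_def by auto
    moreover have "w' p q = w p q - h p - h q" "w' q p = w p q - h p - h q"
      using tw[of p q] tw[of q p] sym[of p q] pq hp by auto
    ultimately show ?thesis
      using hp unfolding H_def by linarith
  qed
  have sym': "w' p q = w' q p" if "p \<in> L" "q \<in> L" "p \<noteq> q" for p q
    using u' that unfolding ultrametric_on_def by blast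
  have ge: "min (H p) (H q) \<le> w p q" if pq: "p \<in> L" "q \<in> L" "p \<noteq> q" for p q
  proof -
    consider "H p < H q" | "H q < H p" | "H p = H q" "h p = h p0" | "H p = H q" "h p0 < h p"
      using hmin[OF pq(1)] by linarith
    then show ?thesis
    proof cases
      case 4
      then have hp: "h p0 < h p" "h p0 < h q" "h p = h q" "p \<noteq> p0" "p0 \<noteq> q" unfolding H_def by auto
      have "min (w' p p0) (w' p0 q) \<le> w' p q" "w' p0 q = w' q p0"
        using tri'[OF pq(1) p0(1) pq(2)] sym'[OF p0(1) pq(2)] pq(3) hp by auto
      moreover have "w' p p0 = D - h p - h p0" "w' q p0 = D - h q - h p0"
        using far0[of p] far0[of q] tw[of p p0] tw[of q p0] hp pq p0(1) by auto
      ultimately show ?thesis using tw[OF pq] hp unfolding H_def by auto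
    qed (use pq near[of p q] near[of q p] sym[of p q] D[of p q] in \<open>auto simp: H_def\<close>)
  qed
  \<comment> \<open>At the largest value of \<open>H\<close> truncation has no effect, so the chain
    ends at \<open>w p q - H p - H q\<close>, which differs from \<open>w'\<close> by a
    constant.\<close>
  let ?M = "Max (H ` L)"
  have M: "?M \<in> H ` L" using fin ne by (intro Max_in) auto
  have "cpic_step\<^sup>*\<^sup>* (weight_pic L w) (weight_pic L (\<lambda>p q. w p q - min (H p) ?M - min (H q) ?M))"
    by (rule weight_pic_truncate[OF fin ev sym ge near M])
  moreover have "cpic_step (weight_pic L (\<lambda>p q. w p q - min (H p) ?M - min (H q) ?M)) (weight_pic L w')"
    using w'H fin by (intro weight_pic_shift[where m = "2 * (D - h p0)"] fin ne) (auto simp: min_absorb1)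
  ultimately show ?thesis by auto
qed

text \<open>The new point has the minimal weight \<open>D\<close> to everything. So \<open>R\<close>
  stops being isolated, as the pair \<open>a\<close>, \<open>b\<close> is no closer than
  \<open>\<rho>\<close>, whereas a smaller isolated set has all its weights above \<open>D\<close>
  and does not notice \<open>\<rho>\<close>.\<close>

lemma isolated_sets_insert:
  assumes fin: "finite R" and \<rho>: "\<rho> \<notin> R"
    and sym: "\<And>q. q \<in> R \<Longrightarrow> w \<rho> q = D" "\<And>q. q \<in> R \<Longrightarrow> w q \<rho> = D"
    and ge: "\<And>p q. p \<in> R \<Longrightarrow> q \<in> R \<Longrightarrow> p \<noteq> q \<Longrightarrow> D \<le> w p q"
    and att: "a \<in> R" "b \<in> R" "a \<noteq> b" "w a b = D"
  shows "isolated_sets (insert \<rho> R) w = (isolated_sets R w \<union> {{\<rho>}, insert \<rho> R}) - {R}"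
proof (intro set_eqI)
  fix t
  let ?L = "insert \<rho> R"
  consider "t = {\<rho>}" | "t = ?L" | "t = R" | q x where "\<rho> \<in> t" "q \<in> t" "q \<noteq> \<rho>" "x \<in> R" "x \<notin> t"
    | y where "t \<subseteq> R" "y \<in> R" "y \<notin> t" | "\<not> t \<subseteq> ?L" | "t = {}"
    by blast
  then show "t \<in> isolated_sets ?L w \<longleftrightarrow> t \<in> isolated_sets R w \<union> {{\<rho>}, ?L} - {R}"
  proof cases
    case 1
    then show ?thesis using \<rho> att by (auto simp: isolated_sets_def)
  next
    case 2
    then show ?thesis using \<rho> by (auto simp: isolated_sets_def)
  next
    case 3
    have "R \<notin> isolated_sets ?L w"
      using isolated_setsD[of R ?L w a b \<rho>] att \<rho> sym by auto
    then show ?thesis using 3 \<rho> by auto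
  next
    case 4
    have "t \<notin> isolated_sets ?L w"
    proof
      assume t: "t \<in> isolated_sets ?L w"
      then have "q \<in> R" using 4 by (auto simp: isolated_sets_def)
      then show False using isolated_setsD[OF t, of \<rho> q x] 4 sym by auto
    qed
    then show ?thesis using 4 \<rho> by (auto simp: isolated_sets_def)
  next
    case 5
    have "D < w p q" if "\<forall>p\<in>t. \<forall>q\<in>t. \<forall>x\<in>R - t. p \<noteq> q \<longrightarrow> w p x < w p q" "p \<in> t" "q \<in> t" "p \<noteq> q" for p q
      using that(1)[rule_format, OF that(2,3) _ that(4), of y] that(2) 5 ge[of p y] by fastforce
    then have "t \<in> isolated_sets ?L w \<longleftrightarrow> t \<in> isolated_sets R w"
      using 5 sym unfolding isolated_sets_def by (auto simp: subset_iff)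
    then show ?thesis using 5 \<rho> by auto
  next
    case 6
    then show ?thesis using \<rho> by (auto simp: isolated_sets_def)
  next
    case 7
    then show ?thesis using \<rho> att by (auto simp: isolated_sets_def)
  qed
qed

lemma weight_pic_add_remove:
  assumes fin: "finite R" and od: "odd (card R)" and \<rho>: "\<rho> \<notin> R" and pr: "proper R"
    and D: "\<And>q. q \<in> R \<Longrightarrow> w \<rho> q = min_depth w R" "\<And>q. q \<in> R \<Longrightarrow> w q \<rho> = min_depth w R"
  shows "cpic_step (weight_pic R w) (weight_pic (insert \<rho> R) w)"
    and "cpic_step (weight_pic (insert \<rho> R) w) (weight_pic R w)"
proof -
  let ?L = "insert \<rho> R" and ?D = "min_depth w R"
  obtain a b where ab: "a \<in> R" "b \<in> R" "a \<noteq> b" "w a b = ?D"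
    using min_depth_attained[OF pr] by metis
  have ge: "?D \<le> w p q" if "p \<in> R" "q \<in> R" "p \<noteq> q" for p q
    using min_depth_le[OF fin that] .
  have iso: "isolated_sets ?L w = (isolated_sets R w \<union> {{\<rho>}, ?L}) - {R}"
    by (rule isolated_sets_insert[where D = ?D and a = a and b = b]) (use fin \<rho> D ge ab in auto)
  have dL: "min_depth w ?L = ?D"
  proof (rule min_depth_eqI[of _ _ _ a b])
    show "?D \<le> w p q" if "p \<in> ?L" "q \<in> ?L" "p \<noteq> q" for p q
      using that ge D by auto
  qed (use fin ab in auto)
  have R: "R \<in> isolated_sets R w" "{\<rho>} \<notin> isolated_sets R w" "?L \<notin> isolated_sets R w" "{\<rho>} \<noteq> R"
    using ab \<rho> by (auto simp: isolated_sets_def)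
  have cp: "cluster_picture (weight_pic R w)" "cluster_picture (weight_pic ?L w)"
    using cluster_picture_weight_pic fin ab by blast+
  have "step_add (weight_pic R w) (weight_pic ?L w)"
    unfolding step_add_def weight_pic_def using od \<rho> iso dL by auto
  then show "cpic_step (weight_pic R w) (weight_pic ?L w)"
    using cp unfolding cpic_step_def by blast
  have "\<not> (\<exists>u\<in>isolated_sets ?L w. {\<rho>} \<subset> u \<and> u \<subset> ?L)"
  proof
    assume "\<exists>u\<in>isolated_sets ?L w. {\<rho>} \<subset> u \<and> u \<subset> ?L"
    then obtain u where u: "u \<in> isolated_sets ?L w" "{\<rho>} \<subset> u" "u \<subset> ?L" by blast
    then have "u \<in> isolated_sets R w" unfolding iso by fast
    then have "u \<subseteq> R" by (simp add: isolated_sets_def)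
    then show False using u(2) \<rho> by auto
  qed
  then have child: "is_child (isolated_sets ?L w) {\<rho>} ?L"
    unfolding is_child_def using ab R \<rho> by (auto simp: iso)
  have "step_remove (weight_pic ?L w) (weight_pic R w)"
    unfolding step_remove_def weight_pic_def prod.case
    using od fin \<rho> dL R child by (intro conjI exI[of _ \<rho>]) (auto simp: iso)
  then show "cpic_step (weight_pic ?L w) (weight_pic R w)"
    using cp unfolding cpic_step_def by blast
qed

lemma iso_weight_pic:
  assumes bij: "bij_betw \<beta> L L'"
    and w: "\<And>p q. p \<in> L \<Longrightarrow> q \<in> L \<Longrightarrow> p \<noteq> q \<Longrightarrow> w' (\<beta> p) (\<beta> q) = w p q"
  shows "iso_cpic (weight_pic L w) (weight_pic L' w')"
proof -
  have inj: "inj_on \<beta> L" and im: "L' = \<beta> ` L" using bij unfolding bij_betw_def by blast+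
  have iso: "\<beta> ` s \<in> isolated_sets L' w' \<longleftrightarrow> s \<in> isolated_sets L w" if s: "s \<subseteq> L" for s
  proof -
    have compl: "L' - \<beta> ` s = \<beta> ` (L - s)" using inj im s by (simp add: inj_on_image_set_diff)
    have step: "(\<beta> p \<noteq> \<beta> q \<longrightarrow> w' (\<beta> p) (\<beta> x) < w' (\<beta> p) (\<beta> q)) \<longleftrightarrow> (p \<noteq> q \<longrightarrow> w p x < w p q)"
      if h: "p \<in> s" "q \<in> s" "x \<in> L - s" for p q x
    proof (cases "p = q")
      case False
      have "p \<in> L" "q \<in> L" "x \<in> L" "p \<noteq> x" using h s by auto
      then show ?thesis using False w[of p x] w[of p q] inj by (auto simp: inj_on_eq_iff)
    qed auto
    have "(\<forall>p\<in>\<beta> ` s. \<forall>q\<in>\<beta> ` s. \<forall>x\<in>L' - \<beta> ` s. p \<noteq> q \<longrightarrow> w' p x < w' p q) \<longleftrightarrow>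
        (\<forall>p\<in>s. \<forall>q\<in>s. \<forall>x\<in>L - s. \<beta> p \<noteq> \<beta> q \<longrightarrow> w' (\<beta> p) (\<beta> x) < w' (\<beta> p) (\<beta> q))"
      unfolding compl by blast
    also have "\<dots> \<longleftrightarrow> (\<forall>p\<in>s. \<forall>q\<in>s. \<forall>x\<in>L - s. p \<noteq> q \<longrightarrow> w p x < w p q)"
      by (intro ball_cong refl step)
    finally show ?thesis
      unfolding isolated_sets_def mem_Collect_eq using s im by (simp add: image_mono)
  qed
  have S: "isolated_sets L' w' = (\<lambda>s. \<beta> ` s) ` isolated_sets L w"
  proof (intro equalityI subsetI)
    fix t assume t: "t \<in> isolated_sets L' w'"
    then have "t \<subseteq> \<beta> ` L" using im by (auto simp: isolated_sets_def)
    then obtain s where st: "s \<subseteq> L" "t = \<beta> ` s" by (auto simp: subset_image_iff)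
    then have "s \<in> isolated_sets L w" using iso[OF st(1)] t by simp
    then show "t \<in> (\<lambda>s. \<beta> ` s) ` isolated_sets L w" using st(2) by blast
  next
    fix t assume "t \<in> (\<lambda>s. \<beta> ` s) ` isolated_sets L w"
    then obtain s where st: "s \<in> isolated_sets L w" "t = \<beta> ` s" by blast
    then have "s \<subseteq> L" by (simp add: isolated_sets_def)
    then show "t \<in> isolated_sets L' w'" using iso st by simp
  qed
  have "min_depth w' (\<beta> ` s) = min_depth w s" if s: "s \<in> isolated_sets L w" for s
  proof -
    have sL: "s \<subseteq> L" using s by (auto simp: isolated_sets_def)
    have "{w' r r' | r r'. r \<in> \<beta> ` s \<and> r' \<in> \<beta> ` s \<and> r \<noteq> r'} = {w r r' | r r'. r \<in> s \<and> r' \<in> s \<and> r \<noteq> r'}"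
      (is "?A = ?B")
    proof (intro equalityI subsetI)
      fix x assume "x \<in> ?A"
      then obtain p q where "x = w' (\<beta> p) (\<beta> q)" "p \<in> s" "q \<in> s" "p \<noteq> q" by auto
      then show "x \<in> ?B" using w sL by blast
    next
      fix x assume "x \<in> ?B"
      then obtain p q where pq: "x = w p q" "p \<in> s" "q \<in> s" "p \<noteq> q" by auto
      moreover have "\<beta> p \<noteq> \<beta> q" using pq sL inj by (auto simp: inj_on_def)
      moreover have "w' (\<beta> p) (\<beta> q) = w p q" using pq sL w by auto
      ultimately show "x \<in> ?A" by (metis (mono_tags, lifting) imageI mem_Collect_eq)
    qed
    then show ?thesis unfolding min_depth_def by simp
  qed
  then show ?thesis
    unfolding iso_cpic_def weight_pic_def using bij S by auto
qed

section \<open>Distances between branch points\<close>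

lemma valuation_one: "is_valuation v \<Longrightarrow> v (1 :: 'b::field) = 0"
  unfolding is_valuation_def by (metis add_cancel_right_right mult_1 zero_neq_one)

lemma valuation_uminus:
  assumes "is_valuation v"
  shows "v (- x :: 'b::field) = v x"
proof (cases "x = 0")
  case False
  have mult: "v (a * b) = v a + v b" if "a \<noteq> 0" "b \<noteq> 0" for a b
    using assms that unfolding is_valuation_def by blast
  have "v (- 1) + v (- 1) = 0" using mult[of "- 1" "- 1"] valuation_one[OF assms] by simp
  then show ?thesis using mult[of "- 1" x] False by simp
qed simp

lemma valuation_diff_commute: "is_valuation v \<Longrightarrow> v (x - y :: 'b::field) = v (y - x)"
  using valuation_uminus[of v "x - y"] by simp

lemma ultrametric_on_valuation:
  fixes R :: "'b::field set"
  assumes v: "is_valuation v"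
  shows "ultrametric_on R (\<lambda>x y. v (x - y))"
proof -
  have "min (v (p - q)) (v (q - r)) \<le> v (p - r)" if "p \<noteq> q" "q \<noteq> r" "p \<noteq> r" for p q r
  proof -
    have "p - q \<noteq> 0" "q - r \<noteq> 0" "(p - q) + (q - r) \<noteq> 0" using that by auto
    then have "min (v (p - q)) (v (q - r)) \<le> v ((p - q) + (q - r))"
      using v unfolding is_valuation_def by blast
    then show ?thesis by simp
  qed
  then show ?thesis
    unfolding ultrametric_on_def using valuation_diff_commute[OF v] by blast
qed

text \<open>Every point of a disc is a centre, so points outside are farther from it than points
  inside. Conversely, an isolated set is cut out by the disc around any of its points
  \<open>p\<close> whose depth is the least valuation of \<open>p - q\<close> over its other points
  \<open>q\<close>.\<close>

lemma disc_traces_eq_isolated_sets: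
  fixes R :: "'b::field set"
  assumes v: "is_valuation v" and fin: "finite R"
  shows "{s. s \<noteq> {} \<and> (\<exists>z d. s = disc v z d \<inter> R)} = isolated_sets R (\<lambda>x y. v (x - y))"
proof (intro equalityI subsetI)
  fix s assume "s \<in> {s. s \<noteq> {} \<and> (\<exists>z d. s = disc v z d \<inter> R)}"
  then obtain z d where s: "s \<noteq> {}" "s = disc v z d \<inter> R" by blast
  have add: "x = z \<or> d \<le> v (x - z)" if "x = y \<or> d \<le> v (x - y)" "y = z \<or> d \<le> v (y - z)" for x y z
  proof -
    have "min (v (x - y)) (v (y - z)) \<le> v (x - z)" if "x \<noteq> y" "y \<noteq> z" "x \<noteq> z"
      using ultrametric_on_valuation[OF v, of UNIV] that unfolding ultrametric_on_def by blast
    then show ?thesis using that by (cases "x = y"; cases "y = z"; cases "x = z") auto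
  qed
  have "v (p - x) < v (p - q)" if "p \<in> s" "q \<in> s" "x \<in> R - s" "p \<noteq> q" for p q x
  proof (rule ccontr)
    assume ge: "\<not> v (p - x) < v (p - q)"
    have p: "p = z \<or> d \<le> v (p - z)" and q: "q = z \<or> d \<le> v (q - z)"
      and x: "x \<noteq> z" "\<not> d \<le> v (x - z)"
      using that s unfolding disc_def by auto
    have "z = q \<or> d \<le> v (z - q)" using q valuation_diff_commute[OF v, of z q] by auto
    then have "d \<le> v (p - q)" using add[OF p] that(4) by blast
    then have "x = p \<or> d \<le> v (x - p)" using ge valuation_diff_commute[OF v, of x p] by auto
    then show False using add[OF _ p] x by blast
  qed
  then show "s \<in> isolated_sets R (\<lambda>x y. v (x - y))"
    unfolding isolated_sets_def using s by auto
next
  fix s assume s: "s \<in> isolated_sets R (\<lambda>x y. v (x - y))"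
  then have sR: "s \<subseteq> R" and ne: "s \<noteq> {}" by (auto simp: isolated_sets_def)
  have fins: "finite s" using sR fin finite_subset by blast
  obtain p where p: "p \<in> s" using ne by auto
  have "\<exists>d. s = disc v p d \<inter> R"
  proof (cases "s = {p}")
    case True
    \<comment> \<open>\<open>Max ?B + 1\<close> exceeds the valuation of \<open>x - p\<close> for
      all \<open>x\<close> in \<open>R\<close>, so a disc of this depth around \<open>p\<close>
      meets \<open>R\<close> in \<open>p\<close> alone.\<close>
    let ?B = "insert 0 ((\<lambda>x. v (x - p)) ` R)"
    have "v (x - p) \<le> Max ?B" if "x \<in> R" for x
      using fin that by (intro Max_ge) auto
    then have "v (x - p) < Max ?B + 1" if "x \<in> R" for x
      using that by (meson less_add_one order_le_less_trans)
    then have "s = disc v p (Max ?B + 1) \<inter> R"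
      unfolding disc_def using True sR by force
    then show ?thesis by blast
  next
    case False
    let ?B = "(\<lambda>x. v (p - x)) ` (s - {p})"
    have B: "finite ?B" "?B \<noteq> {}" using fins False p by auto
    then obtain q where q: "q \<in> s" "q \<noteq> p" "Min ?B = v (p - q)"
      using Min_in[OF B] unfolding image_iff by blast
    have "x \<in> s \<longleftrightarrow> x = p \<or> Min ?B \<le> v (x - p)" if "x \<in> R" for x
    proof
      assume "x \<in> s"
      then show "x = p \<or> Min ?B \<le> v (x - p)"
        using Min_le[OF B(1), of "v (p - x)"] valuation_diff_commute[OF v, of x p] by auto
    next
      assume "x = p \<or> Min ?B \<le> v (x - p)"
      then have "x = p \<or> v (p - q) \<le> v (p - x)"
        using q(3) valuation_diff_commute[OF v, of x p] by simp
      then show "x \<in> s"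
        using isolated_setsD[OF s p q(1) q(2)[symmetric] that] p by fastforce
    qed
    then have "s = disc v p (Min ?B) \<inter> R" unfolding disc_def using sR by auto
    then show ?thesis by blast
  qed
  then show "s \<in> {s. s \<noteq> {} \<and> (\<exists>z d. s = disc v z d \<inter> R)}" using ne by blast
qed

lemma curve_cluster_picture_eq:
  assumes "is_valuation v" "finite (roots_of \<iota> f)"
  shows "curve_cluster_picture \<iota> v f = weight_pic (roots_of \<iota> f) (\<lambda>x y. v (x - y))"
  unfolding curve_cluster_picture_def weight_pic_def Let_def min_depth_def
  using disc_traces_eq_isolated_sets[OF assms] by simp

text \<open>Points of the projective line are modelled by the option type, with \<^term>\<open>None\<close> at
  infinity; the bracket is the determinant of homogeneous coordinates \<open>(a, 1)\<close> and \<open>(1, 0)\<close>.\<close>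

definition branch_points :: "'b set \<Rightarrow> 'b option set" where
  "branch_points R = Some ` R \<union> (if odd (card R) then {None} else {})"

definition bracket :: "'b::field option \<Rightarrow> 'b option \<Rightarrow> 'b" where
  "bracket p q = (case p of None \<Rightarrow> (case q of None \<Rightarrow> 0 | Some b \<Rightarrow> 1)
     | Some a \<Rightarrow> (case q of None \<Rightarrow> - 1 | Some b \<Rightarrow> a - b))"

text \<open>Infinity gets the distance that a root created by the adding step would have: the depth
  of \<open>R\<close>, to every root.\<close>

definition branch_weight :: "('b::field \<Rightarrow> rat) \<Rightarrow> 'b set \<Rightarrow> 'b option \<Rightarrow> 'b option \<Rightarrow> rat" where
  "branch_weight v R p q = (case (p, q) of (Some a, Some b) \<Rightarrow> v (a - b)
     | _ \<Rightarrow> min_depth (\<lambda>x y. v (x - y)) R)"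

lemma branch_weight_simps [simp]:
  "branch_weight v R (Some a) (Some b) = v (a - b)"
  "branch_weight v R None q = min_depth (\<lambda>x y. v (x - y)) R"
  "branch_weight v R p None = min_depth (\<lambda>x y. v (x - y)) R"
  unfolding branch_weight_def by (auto split: option.splits)

lemma even_card_branch_points: "finite R \<Longrightarrow> even (card (branch_points R))"
  unfolding branch_points_def by (auto simp: card_insert_if card_image)

lemma ultrametric_on_branch_weight:
  assumes v: "is_valuation v" and fin: "finite R"
  shows "ultrametric_on (branch_points R) (branch_weight v R)"
proof -
  have ge: "min_depth (\<lambda>x y. v (x - y)) R \<le> v (a - b)" if "a \<in> R" "b \<in> R" "a \<noteq> b" for a b
    using min_depth_le[OF fin that, of "\<lambda>x y. v (x - y)"] by simp
  have "min (branch_weight v R p q) (branch_weight v R q r) \<le> branch_weight v R p r"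
    if "p \<in> branch_points R" "q \<in> branch_points R" "r \<in> branch_points R" "p \<noteq> q" "q \<noteq> r" "p \<noteq> r" for p q r
  proof -
    have "min (v (a - b)) (v (b - c)) \<le> v (a - c)" if "a \<noteq> b" "b \<noteq> c" "a \<noteq> c" for a b c
      using ultrametric_on_valuation[OF v, of UNIV] that unfolding ultrametric_on_def by blast
    then show ?thesis
      using that ge by (cases p; cases q; cases r) (auto simp: branch_points_def split: if_splits)
  qed
  moreover have "branch_weight v R p q = branch_weight v R q p" for p q
    using valuation_diff_commute[OF v] by (cases p; cases q) auto
  ultimately show ?thesis unfolding ultrametric_on_def by blast
qed

text \<open>Steps do not change the type of the points, so for odd \<open>card R\<close> a fresh
  field element \<open>\<rho>\<close> stands for infinity; \<open>e\<close> records which branch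
  point a label denotes.\<close>

lemma weight_pic_add_infinity:
  fixes R :: "'b::field set"
  assumes inf: "infinite (UNIV :: 'b set)" and fin: "finite R" and pr: "proper R"
  obtains L e where "finite L" "bij_betw e L (branch_points R)"
    "cpic_step\<^sup>*\<^sup>* (weight_pic R (\<lambda>x y. v (x - y))) (weight_pic L (\<lambda>p q. branch_weight v R (e p) (e q)))"
proof (cases "odd (card R)")
  case False
  have "bij_betw Some R (branch_points R)"
    using False unfolding branch_points_def by (auto intro: bij_betw_imageI)
  then show ?thesis using fin by (intro that[of R Some]) auto
next
  case True
  obtain \<rho> where \<rho>: "\<rho> \<notin> R" using inf fin ex_new_if_finite by blast
  define e where "e x = (if x = \<rho> then None else Some x)" for x
  let ?w = "\<lambda>p q. branch_weight v R (e p) (e q)"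
  have bij: "bij_betw e (insert \<rho> R) (branch_points R)"
    using True \<rho> unfolding branch_points_def e_def
    by (intro bij_betw_imageI) (auto simp: inj_on_def image_iff)
  have ne: "R \<noteq> {}" using pr unfolding proper_def by auto
  have w: "?w p q = v (p - q) + 0" if "p \<in> R" "q \<in> R" for p q
    using that \<rho> unfolding e_def by auto
  have "min_depth ?w R = min_depth (\<lambda>x y. v (x - y)) R"
    using min_depth_add[OF pr, of ?w "\<lambda>x y. v (x - y)" 0] w by simp
  then have "cpic_step (weight_pic R ?w) (weight_pic (insert \<rho> R) ?w)"
    by (intro weight_pic_add_remove(1) fin True \<rho> pr) (simp_all add: e_def)
  \<comment> \<open>The two depth functions agree on the clusters of \<open>R\<close> but need not
    be equal as functions; a shift by 0 bridges the gap.\<close>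
  moreover have "cpic_step (weight_pic R (\<lambda>x y. v (x - y))) (weight_pic R ?w)"
    using w by (intro weight_pic_shift[where m = 0] fin ne) auto
  ultimately show ?thesis
    using fin bij by (intro that[of "insert \<rho> R" e]) auto
qed

text \<open>The labels may stem from another curve, so the root to be removed is whichever label
  \<open>e\<close> sends to \<open>None\<close>, and the roots are recovered only up to the
  isomorphism \<open>the \<circ> e\<close>.\<close>

lemma weight_pic_remove_infinity:
  fixes R :: "'b::field set"
  assumes fin: "finite R" and pr: "proper R" and finL: "finite L"
    and bij: "bij_betw e L (branch_points R)"
  obtains X where "cpic_step\<^sup>*\<^sup>* (weight_pic L (\<lambda>p q. branch_weight v R (e p) (e q))) X"
    "iso_cpic X (weight_pic R (\<lambda>x y. v (x - y)))"
proof -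
  let ?w = "\<lambda>p q. branch_weight v R (e p) (e q)"
  have iso: "iso_cpic (weight_pic M ?w) (weight_pic R (\<lambda>x y. v (x - y)))"
    "bij_betw (the \<circ> e) M R" "\<And>p q. p \<in> M \<Longrightarrow> q \<in> M \<Longrightarrow> ?w p q = v ((the \<circ> e) p - (the \<circ> e) q)"
    if M: "bij_betw e M (Some ` R)" for M
  proof -
    have "bij_betw the (Some ` R) R" by (auto intro!: bij_betw_imageI inj_onI simp: image_image)
    then show b: "bij_betw (the \<circ> e) M R" using bij_betw_trans[OF M] by blast
    have eS: "e p \<in> Some ` R" if "p \<in> M" for p using M that bij_betwE by blast
    show w: "?w p q = v ((the \<circ> e) p - (the \<circ> e) q)" if "p \<in> M" "q \<in> M" for p q
      using eS[OF that(1)] eS[OF that(2)] by auto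
    show "iso_cpic (weight_pic M ?w) (weight_pic R (\<lambda>x y. v (x - y)))"
      by (rule iso_weight_pic[OF b]) (simp add: w del: comp_apply)
  qed
  show ?thesis
  proof (cases "odd (card R)")
    case False
    then have "bij_betw e L (Some ` R)" using bij unfolding branch_points_def by simp
    then show ?thesis using iso by (intro that[of "weight_pic L ?w"]) auto
  next
    case True
    have "None \<in> e ` L" using bij True unfolding bij_betw_def branch_points_def by auto
    then obtain \<rho> where \<rho>: "\<rho> \<in> L" "e \<rho> = None" by auto
    let ?M = "L - {\<rho>}"
    have "bij_betw e ?M (branch_points R - {None})"
      using bij_betw_DiffI[OF bij, of "{\<rho>}" "{None}"] \<rho> \<open>None \<in> e ` L\<close> bij
      by (auto simp: bij_betw_def)
    moreover have "branch_points R - {None} = Some ` R" unfolding branch_points_def by auto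
    ultimately have M: "bij_betw e ?M (Some ` R)" by simp
    note isoM = iso[OF M]
    have cM: "card ?M = card R" using bij_betw_same_card[OF isoM(2)] .
    then have prM: "proper ?M" using pr unfolding proper_def by simp
    obtain a b where ab: "a \<in> R" "b \<in> R" "a \<noteq> b" "min_depth (\<lambda>x y. v (x - y)) R = v (a - b)"
      using min_depth_attained[OF pr, of "\<lambda>x y. v (x - y)"] .
    have "a \<in> (the \<circ> e) ` ?M" "b \<in> (the \<circ> e) ` ?M" using isoM(2) ab unfolding bij_betw_def by auto
    then obtain a' b' where a': "a' \<in> ?M" "b' \<in> ?M" "(the \<circ> e) a' = a" "(the \<circ> e) b' = b" by blast
    have D: "min_depth ?w ?M = min_depth (\<lambda>x y. v (x - y)) R"
    proof (rule min_depth_eqI[of _ _ _ a' b'])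
      fix p q assume pq: "p \<in> ?M" "q \<in> ?M" "p \<noteq> q"
      have "(the \<circ> e) p \<noteq> (the \<circ> e) q" "(the \<circ> e) p \<in> R" "(the \<circ> e) q \<in> R"
        using isoM(2) pq unfolding bij_betw_def by (blast dest: inj_onD)+
      then show "min_depth (\<lambda>x y. v (x - y)) R \<le> ?w p q"
        using isoM(3)[OF pq(1,2)] min_depth_le[OF fin, of _ _ "\<lambda>x y. v (x - y)"] by simp
    qed (use finL a' ab isoM(3)[OF a'(1,2)] in auto)
    have "cpic_step (weight_pic (insert \<rho> ?M) ?w) (weight_pic ?M ?w)"
      using finL True cM prM D \<rho> by (intro weight_pic_add_remove(2)) auto
    moreover have "insert \<rho> ?M = L" using \<rho> by auto
    ultimately show ?thesis using isoM(1) by (intro that[of "weight_pic ?M ?w"]) auto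
  qed
qed

lemma equivalent_of_bracket_twist:
  fixes R1 R2 :: "'b::field set"
  assumes v: "is_valuation v" and inf: "infinite (UNIV :: 'b set)"
    and R1: "finite R1" "proper R1" and R2: "finite R2" "proper R2"
    and bij: "bij_betw \<beta> (branch_points R1) (branch_points R2)"
    and tw: "\<And>p q. p \<in> branch_points R1 \<Longrightarrow> q \<in> branch_points R1 \<Longrightarrow> p \<noteq> q \<Longrightarrow>
      v (bracket (\<beta> p) (\<beta> q)) = v (bracket p q) - h p - h q"
  shows "equivalent_cpic (weight_pic R1 (\<lambda>x y. v (x - y))) (weight_pic R2 (\<lambda>x y. v (x - y)))"
proof -
  obtain L e where L: "finite L" "bij_betw e L (branch_points R1)"
    "cpic_step\<^sup>*\<^sup>* (weight_pic R1 (\<lambda>x y. v (x - y))) (weight_pic L (\<lambda>p q. branch_weight v R1 (e p) (e q)))"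
    using weight_pic_add_infinity[OF inf R1] .
  \<comment> \<open>\<open>N\<close> translates between two conventions at infinity: brackets with
    \<open>None\<close> have valuation 0, whereas \<open>branch_weight\<close> takes the depth of
    the roots. The correction is a sum over the two endpoints, so it can be absorbed into the
    twist.\<close>
  define N where "N R p = (case p of None \<Rightarrow> - min_depth (\<lambda>x y. v (x - y)) R | Some a \<Rightarrow> 0)"
    for R :: "'b set" and p :: "'b option"
  have one: "v 1 = 0" "v (- 1) = 0" using valuation_one[OF v] valuation_uminus[OF v, of 1] by auto
  have bw: "branch_weight v R p q = v (bracket p q) - N R p - N R q" if "p \<noteq> q" for R p q
    using that one by (cases p; cases q) (auto simp: N_def bracket_def)
  have bij2: "bij_betw (\<beta> \<circ> e) L (branch_points R2)" using bij_betw_trans[OF L(2) bij] .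
  have pull: "ultrametric_on L (\<lambda>p q. branch_weight v R (f p) (f q))"
    if "bij_betw f L (branch_points R)" "finite R" for f R
  proof -
    have "f p \<in> branch_points R" if "p \<in> L" for p using \<open>bij_betw f L _\<close> that bij_betwE by blast
    moreover have "f p = f q \<longleftrightarrow> p = q" if "p \<in> L" "q \<in> L" for p q
      using \<open>bij_betw f L _\<close> that by (auto simp: bij_betw_def inj_on_eq_iff)
    ultimately show ?thesis
      using ultrametric_on_branch_weight[OF v that(2)] unfolding ultrametric_on_def by blast
  qed
  have card: "card L = card (branch_points R1)" using bij_betw_same_card[OF L(2)] .
  have "card R1 \<le> card (branch_points R1)"
    using R1 card_mono[of "branch_points R1" "Some ` R1"] by (auto simp: branch_points_def card_image)
  then have prL: "proper L" using R1 card unfolding proper_def by simp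
  have "cpic_step\<^sup>*\<^sup>* (weight_pic L (\<lambda>p q. branch_weight v R1 (e p) (e q)))
      (weight_pic L (\<lambda>p q. branch_weight v R2 ((\<beta> \<circ> e) p) ((\<beta> \<circ> e) q)))"
  proof (rule weight_pic_twist[where h = "\<lambda>p. h (e p) - N R1 (e p) + N R2 (\<beta> (e p))"])
    show "even (card L)" using card even_card_branch_points[OF R1(1)] by simp
    fix p q assume pq: "p \<in> L" "q \<in> L" "p \<noteq> q"
    have "e p \<in> branch_points R1" "e q \<in> branch_points R1" "e p \<noteq> e q" "\<beta> (e p) \<noteq> \<beta> (e q)"
      using pq L(2) bij2 by (auto simp: bij_betw_def inj_on_def)
    then show "branch_weight v R2 ((\<beta> \<circ> e) p) ((\<beta> \<circ> e) q) = branch_weight v R1 (e p) (e q)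
        - (h (e p) - N R1 (e p) + N R2 (\<beta> (e p))) - (h (e q) - N R1 (e q) + N R2 (\<beta> (e q)))"
      using tw[of "e p" "e q"] by (simp add: bw)
  qed (use L prL pull[OF L(2) R1(1)] pull[OF bij2 R2(1)] in auto)
  moreover obtain X where "cpic_step\<^sup>*\<^sup>* (weight_pic L (\<lambda>p q. branch_weight v R2 ((\<beta> \<circ> e) p) ((\<beta> \<circ> e) q))) X"
    "iso_cpic X (weight_pic R2 (\<lambda>x y. v (x - y)))"
    using weight_pic_remove_infinity[OF R2 L(1) bij2] .
  ultimately show ?thesis
    using L(3) unfolding equivalent_cpic_def by (meson rtranclp_trans)
qed

section \<open>Bounding the degree of primitive factors\<close>

locale ring_map =
  fixes h :: "'r::comm_ring_1 \<Rightarrow> 's::comm_ring_1"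
  assumes hom_0: "h 0 = 0" and hom_1: "h 1 = 1"
    and hom_add: "h (a + b) = h a + h b" and hom_mult: "h (a * b) = h a * h b"
begin

lemma hom_uminus: "h (- a) = - h a"
  using hom_add[of a "- a"] hom_0 by (simp add: eq_neg_iff_add_eq_0 add.commute)

lemma hom_diff: "h (a - b) = h a - h b"
  using hom_add[of a "- b"] hom_uminus[of b] by simp

lemma hom_sum: "h (sum f A) = (\<Sum>x\<in>A. h (f x))"
  by (induction A rule: infinite_finite_induct) (simp_all add: hom_0 hom_add)

lemma hom_power: "h (a ^ n) = h a ^ n"
  by (induction n) (simp_all add: hom_1 hom_mult)

lemma map_poly_hom_mult: "map_poly h (p * q) = map_poly h p * map_poly h q"
  by (rule poly_eqI) (simp add: coeff_map_poly hom_0 coeff_mult hom_sum hom_mult)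

lemma ring_map_map_poly: "ring_map (map_poly h)"
proof
  show "map_poly h (p + q) = map_poly h p + map_poly h q" for p q
    by (rule poly_eqI) (simp add: coeff_map_poly hom_0 hom_add)
qed (simp_all add: map_poly_hom_mult hom_1)

lemma poly_map_poly_hom: "poly (map_poly h p) (h x) = h (poly p x)"
  by (induction p) (simp_all add: map_poly_pCons hom_0 hom_add hom_mult)

lemma map_poly_hom_smult: "map_poly h (smult c p) = smult (h c) (map_poly h p)"
  by (rule poly_eqI) (simp add: coeff_map_poly hom_0 hom_mult)

end

lemma ring_map_to_fract: "ring_map (to_fract :: 'r::idom \<Rightarrow> 'r fract)"
  by unfold_locales simp_all

lemma ring_map_poly_eval: "ring_map (\<lambda>p :: 'r::comm_ring_1 poly. poly p z)"
  by unfold_locales simp_all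

lemma ring_map_field_embedding: "field_embedding \<iota> \<Longrightarrow> ring_map \<iota>"
  unfolding field_embedding_def by unfold_locales auto

lemma map_poly_inject:
  assumes "inj h" "h 0 = 0"
  shows "map_poly h p = map_poly h q \<longleftrightarrow> p = q"
proof
  assume "map_poly h p = map_poly h q"
  then have "h (coeff p n) = h (coeff q n)" for n
    using coeff_map_poly[of h p n] coeff_map_poly[of h q n] assms by simp
  then show "p = q" using assms(1) by (intro poly_eqI) (auto dest: injD)
qed simp

lemma inj_map_poly: "inj h \<Longrightarrow> h 0 = 0 \<Longrightarrow> inj (map_poly h)"
  by (rule injI) (simp add: map_poly_inject)

text \<open>Coprimality of \<open>p\<close> and \<open>a\<close> is expressed by roots. Each root of
  \<open>p\<close> must be a root of \<open>e\<close>, and its linear factor cancels from both,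
  which lowers both degrees by one.\<close>

lemma degree_le_of_dvd_mult:
  fixes p a e :: "'b::field poly"
  assumes closed: "\<And>p :: 'b poly. degree p \<ge> 1 \<Longrightarrow> \<exists>z. poly p z = 0"
    and "p dvd a * e" "e \<noteq> 0" "\<And>z. poly p z = 0 \<Longrightarrow> poly a z \<noteq> 0"
  shows "degree p \<le> degree e"
  using assms(2-)
proof (induction "degree p" arbitrary: p e)
  case (Suc n)
  obtain z where z: "poly p z = 0" using closed[of p] Suc.hyps by auto
  then obtain p' where p': "p = [:- z, 1:] * p'" by (metis dvdE poly_eq_0_iff_dvd)
  obtain k where k: "a * e = p * k" using Suc.prems(1) by (rule dvdE)
  have "poly (a * e) z = 0" using k z by simp
  then have "poly e z = 0" using Suc.prems(3)[OF z] by simp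
  then obtain e' where e': "e = [:- z, 1:] * e'" by (metis dvdE poly_eq_0_iff_dvd)
  have p'0: "p' \<noteq> 0" using Suc.hyps(2) p' by auto
  have e'0: "e' \<noteq> 0" using Suc.prems(2) e' by auto
  have "[:- z, 1:] * (a * e') = [:- z, 1:] * (p' * k)"
    using k unfolding p' e' by (simp only: mult_ac)
  then have "a * e' = p' * k" using mult_left_cancel[of "[:- z, 1:]"] by simp
  moreover have dp: "degree p = Suc (degree p')" "degree e = Suc (degree e')"
    unfolding p' e' using p'0 e'0 by (subst degree_mult_eq; simp)+
  moreover have "poly a y \<noteq> 0" if "poly p' y = 0" for y
    using Suc.prems(3)[of y] that unfolding p' by simp
  ultimately have "degree p' \<le> degree e'" using Suc.hyps e'0 by (intro Suc.hyps(1)) auto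
  then show ?case using dp by simp
qed simp

text \<open>Over an algebraically closed field this is primitivity in the sense of Gauss: a
  nonconstant common factor of the coefficients would have a root.\<close>

definition primitive_coeffs :: "'b::field poly poly \<Rightarrow> bool" where
  "primitive_coeffs G \<longleftrightarrow> (\<forall>z. \<exists>i. poly (coeff G i) z \<noteq> 0)"

text \<open>Common linear factors are divided out one at a time; each lowers the degree of the
  leading coefficient, so this terminates.\<close>

lemma primitive_coeffs_exists:
  fixes G :: "'b::field poly poly"
  assumes "G \<noteq> 0"
  obtains g G' where "g \<noteq> 0" "G = smult g G'" "primitive_coeffs G'"
  using assms
proof (induction "degree (lead_coeff G)" arbitrary: G thesis rule: less_induct)
  case less
  show ?case
  proof (cases "primitive_coeffs G")
    case True
    then show ?thesis using less.prems(1)[of 1 G] by simp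
  next
    case False
    then obtain z where z: "\<And>i. poly (coeff G i) z = 0" unfolding primitive_coeffs_def by blast
    let ?l = "[:- z, 1:]"
    define H where "H = map_poly (\<lambda>p. p div ?l) G"
    have G: "G = smult ?l H"
    proof (rule poly_eqI)
      fix i
      have "?l dvd coeff G i" using z poly_eq_0_iff_dvd by blast
      then show "coeff G i = coeff (smult ?l H) i"
        unfolding H_def by (simp add: coeff_map_poly del: mult_pCons_left)
    qed
    then have H0: "H \<noteq> 0" using less.prems(2) by auto
    have "lead_coeff G = ?l * lead_coeff H" by (subst (1 2) G) (simp add: degree_smult_eq del: mult_pCons_left)
    then have "degree (lead_coeff G) = Suc (degree (lead_coeff H))"
      using H0 by (simp add: degree_mult_eq del: mult_pCons_left)
    then obtain g G' where "g \<noteq> 0" "H = smult g G'" "primitive_coeffs G'"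
      using less.hyps[OF _ _ H0] by auto
    then show ?thesis using G less.prems(1)[of "?l * g" G'] by (simp del: mult_pCons_left)
  qed
qed

lemma coeff_poly_const_poly:
  "coeff (poly G [:c:]) n = poly (map_poly (\<lambda>p. coeff p n) G) (c :: 'b::comm_ring_1)"
  by (induction G) (simp_all add: map_poly_pCons)

text \<open>A form of Gauss' lemma: specialising the outer variable to a generic constant makes the
  specialisation of a primitive \<open>G\<close> coprime to \<open>a\<close> without dropping its degree.\<close>

lemma degree_coeff_le_of_primitive_dvd:
  fixes E G Q :: "'b::field poly poly"
  assumes closed: "\<And>p :: 'b poly. degree p \<ge> 1 \<Longrightarrow> \<exists>z. poly p z = 0"
    and inf: "infinite (UNIV :: 'b set)"
    and eq: "smult a E = G * Q" and a: "a \<noteq> 0" and E: "E \<noteq> 0"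
    and prim: "primitive_coeffs G" and deg: "\<And>i. degree (coeff E i) \<le> d"
  shows "degree (coeff G i) \<le> d"
proof (cases "coeff G i = 0")
  case False
  define N where "N = degree (coeff G i)"
  let ?top = "map_poly (\<lambda>p. coeff p N) G"
  let ?at = "\<lambda>z. map_poly (\<lambda>p. poly p z) G"
  have "coeff ?top i \<noteq> 0" using False by (simp add: coeff_map_poly N_def)
  then have top: "?top \<noteq> 0" by auto
  have at: "?at z \<noteq> 0" for z
  proof -
    obtain j where "poly (coeff G j) z \<noteq> 0" using prim unfolding primitive_coeffs_def by blast
    then have "coeff (?at z) j \<noteq> 0" by (simp add: coeff_map_poly)
    then show ?thesis by auto
  qed
  \<comment> \<open>The values \<open>c\<close> to avoid: those that lose the top inner degree
    \<open>N\<close> of \<open>G\<close>, those that kill \<open>E\<close>, and those that give the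
    specialised \<open>G\<close> a common root with \<open>a\<close>. The last are finitely many
    because primitivity keeps \<open>?at z\<close> nonzero.\<close>
  let ?bad = "{c. poly ?top c = 0} \<union> {c. poly E [:c:] = 0} \<union> (\<Union>z\<in>{z. poly a z = 0}. {c. poly (?at z) c = 0})"
  have "inj (\<lambda>c :: 'b. [:c:])" by (rule injI) simp
  then have "finite {c. poly E [:c:] = 0}"
    using finite_vimageI[OF poly_roots_finite[OF E], of "\<lambda>c. [:c:]"] by (simp add: vimage_def)
  then have "finite ?bad" using top at a by (auto simp: poly_roots_finite)
  from ex_new_if_finite[OF inf this] obtain c where "c \<notin> ?bad" by (rule exE)
  then have c: "poly ?top c \<noteq> 0" "poly E [:c:] \<noteq> 0" "\<And>z. poly a z = 0 \<Longrightarrow> poly (?at z) c \<noteq> 0"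
    by auto
  have "a * poly E [:c:] = poly G [:c:] * poly Q [:c:]"
    using arg_cong[OF eq, of "\<lambda>p. poly p [:c:]"] by simp
  then have "poly G [:c:] dvd a * poly E [:c:]" by simp
  moreover have "poly a z \<noteq> 0" if "poly (poly G [:c:]) z = 0" for z
    using c(3)[of z] that ring_map.poly_map_poly_hom[OF ring_map_poly_eval, of z G "[:c:]"] by auto
  ultimately have "degree (poly G [:c:]) \<le> degree (poly E [:c:])"
    using degree_le_of_dvd_mult[OF closed] c(2) by blast
  moreover have "N \<le> degree (poly G [:c:])"
    using c(1) by (intro le_degree) (simp add: coeff_poly_const_poly)
  moreover have "degree (poly E [:c:]) \<le> d"
  proof (rule degree_le, intro allI impI)
    fix n assume "d < n"
    then have "map_poly (\<lambda>p. coeff p n) E = 0"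
      using deg by (intro poly_eqI) (simp add: coeff_map_poly, meson coeff_eq_0 le_less_trans)
    then show "coeff (poly E [:c:]) n = 0" by (simp add: coeff_poly_const_poly)
  qed
  ultimately show ?thesis unfolding N_def by simp
qed simp

lemma fract_eq_quotient:
  obtains n d where "d \<noteq> 0" "(x :: 'r::idom fract) = to_fract n / to_fract d"
  by (cases x) (metis Fract_conv_to_fract)

lemma clear_denominators:
  fixes q :: "'r::idom fract poly"
  obtains a Q where "a \<noteq> 0" "smult (to_fract a) q = map_poly to_fract Q"
proof (induction q arbitrary: thesis)
  case 0
  then show ?case using 0[of 1 0] by simp
next
  case (pCons x q)
  obtain a Q where aQ: "a \<noteq> 0" "smult (to_fract a) q = map_poly to_fract Q" using pCons.IH .
  obtain n d where nd: "d \<noteq> 0" "x = to_fract n / to_fract d" by (rule fract_eq_quotient)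
  have "smult (to_fract (a * d)) (pCons x q) = pCons (to_fract (a * n)) (smult (to_fract d) (smult (to_fract a) q))"
    using nd by (simp add: mult.commute)
  also have "\<dots> = map_poly to_fract (pCons (a * n) (smult d Q))"
    unfolding aQ(2) by (simp add: map_poly_pCons ring_map.map_poly_hom_smult[OF ring_map_to_fract])
  finally show ?case using pCons.prems aQ nd by (metis mult_eq_0_iff)
qed

text \<open>Denominators are cleared over \<open>K\<close>, but the content \<open>g\<close> is
  removed only over the closure, where it splits into linear factors. Hence \<open>A\<close> and
  \<open>G\<close> live over \<open>'a\<close>, and \<open>g\<close> and \<open>G'\<close> over
  \<open>'b\<close>.\<close>

lemma primitive_factor_degree_le:
  fixes \<iota> :: "'a::field \<Rightarrow> 'b::field" and G0 :: "'a poly fract poly" and E :: "'a poly poly"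
  assumes closed: "\<And>p :: 'b poly. degree p \<ge> 1 \<Longrightarrow> \<exists>z. poly p z = 0"
    and inf: "infinite (UNIV :: 'b set)" and emb: "field_embedding \<iota>"
    and dvd: "G0 dvd map_poly to_fract E" and E: "E \<noteq> 0" and deg: "\<And>i. degree (coeff E i) \<le> d"
  obtains A G g G' where "A \<noteq> 0" "smult (to_fract A) G0 = map_poly to_fract G" "g \<noteq> 0"
    "map_poly (map_poly \<iota>) G = smult g G'" "primitive_coeffs G'" "\<And>i. degree (coeff G' i) \<le> d"
proof -
  interpret \<iota>: ring_map \<iota> by (rule ring_map_field_embedding[OF emb])
  interpret \<iota>p: ring_map "map_poly \<iota>" by (rule \<iota>.ring_map_map_poly)
  interpret fr: ring_map "to_fract :: 'a poly \<Rightarrow> _" by (rule ring_map_to_fract)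
  have inj\<iota>: "inj \<iota>" using emb unfolding field_embedding_def by blast
  have inj1: "inj (map_poly \<iota>)" using inj\<iota> \<iota>.hom_0 by (rule inj_map_poly)
  have inj2: "inj (map_poly (map_poly \<iota>))" using inj1 by (rule inj_map_poly) simp
  have injf: "inj (to_fract :: 'a poly \<Rightarrow> _)" by (rule injI) simp
  obtain q where q: "map_poly to_fract E = G0 * q" using dvd by (rule dvdE)
  obtain A G where AG: "A \<noteq> 0" "smult (to_fract A) G0 = map_poly to_fract G"
    using clear_denominators .
  obtain a Q where aQ: "a \<noteq> 0" "smult (to_fract a) q = map_poly to_fract Q"
    using clear_denominators .
  have "map_poly to_fract (smult (A * a) E) = smult (to_fract A) G0 * smult (to_fract a) q"
    by (simp add: fr.map_poly_hom_smult q mult.commute)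
  also have "\<dots> = map_poly to_fract (G * Q)"
    unfolding AG(2) aQ(2) fr.map_poly_hom_mult ..
  finally have GQ: "smult (A * a) E = G * Q" by (rule map_poly_inject[OF injf fr.hom_0, THEN iffD1])
  then have "G \<noteq> 0" using AG(1) aQ(1) E by auto
  then have "map_poly (map_poly \<iota>) G \<noteq> 0"
    using map_poly_inject[OF inj1, of G 0] by simp
  then obtain g G' where g: "g \<noteq> 0" "map_poly (map_poly \<iota>) G = smult g G'" "primitive_coeffs G'"
    by (rule primitive_coeffs_exists)
  have "smult (map_poly \<iota> (A * a)) (map_poly (map_poly \<iota>) E) = G' * smult g (map_poly (map_poly \<iota>) Q)"
    using arg_cong[OF GQ, of "map_poly (map_poly \<iota>)"]
    by (simp add: \<iota>p.map_poly_hom_smult \<iota>p.map_poly_hom_mult g(2))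
  moreover have "map_poly \<iota> (A * a) \<noteq> 0"
    using map_poly_inject[OF inj\<iota> \<iota>.hom_0, of "A * a" 0] AG aQ by simp
  moreover have "map_poly (map_poly \<iota>) E \<noteq> 0" using map_poly_inject[OF inj1, of E 0] E by simp
  moreover have "degree (coeff (map_poly (map_poly \<iota>) E) i) \<le> d" for i
    using deg[of i] by (auto simp: coeff_map_poly \<iota>.hom_0 coeff_eq_0 intro!: degree_le)
  ultimately have "degree (coeff G' i) \<le> d" for i
    using degree_coeff_le_of_primitive_dvd[OF closed inf] g(3) by blast
  then show ?thesis using AG g that by blast
qed

text \<open>Square factors change orders by even numbers, so equality up to squares preserves the
  set of points of odd order.\<close>

lemma order_parity:
  fixes f F P Q :: "'b::field poly"
  assumes "P\<^sup>2 * f = Q\<^sup>2 * F" "P \<noteq> 0" "f \<noteq> 0"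
  shows "Q \<noteq> 0" "F \<noteq> 0" "even (order z f) \<longleftrightarrow> even (order z F)"
proof -
  have nz: "P\<^sup>2 * f \<noteq> 0" using assms(2,3) by simp
  then show QF: "Q \<noteq> 0" "F \<noteq> 0" unfolding assms(1) by auto
  have "order z (P\<^sup>2 * f) = 2 * order z P + order z f"
    using nz assms(2,3) by (simp add: order_mult power2_eq_square)
  moreover have "order z (Q\<^sup>2 * F) = 2 * order z Q + order z F"
    using QF by (simp add: order_mult power2_eq_square)
  ultimately show "even (order z f) \<longleftrightarrow> even (order z F)"
    using assms(1) by (metis even_add even_mult_iff even_numeral)
qed

lemma separable_factorization:
  fixes f :: "'b::field poly"
  assumes closed: "\<And>p :: 'b poly. degree p \<ge> 1 \<Longrightarrow> \<exists>z. poly p z = 0"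
    and f: "f \<noteq> 0" and sep: "\<And>z. poly f z = 0 \<Longrightarrow> order z f = 1"
  shows "f = smult (lead_coeff f) (\<Prod>a | poly f a = 0. [:- a, 1:])"
    and "card {a. poly f a = 0} = degree f"
proof -
  let ?R = "{a. poly f a = 0}"
  have fin: "finite ?R" using f by (rule poly_roots_finite)
  have "(\<Prod>a\<in>T. [:- a, 1:]) dvd f" if "finite T" "T \<subseteq> ?R" for T
    using that
  proof (induction T rule: finite_induct)
    case (insert a T)
    then obtain k where k: "f = (\<Prod>a\<in>T. [:- a, 1:]) * k" by auto
    have "poly (\<Prod>a\<in>T. [:- a, 1:]) a \<noteq> 0" using insert.hyps by (simp add: poly_prod)
    moreover have "poly f a = 0" using insert.prems by auto
    ultimately have "poly k a = 0" using k by (metis mult_eq_0_iff poly_mult)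
    then have "[:- a, 1:] dvd k" by (simp add: poly_eq_0_iff_dvd)
    then have "(\<Prod>a\<in>T. [:- a, 1:]) * [:- a, 1:] dvd f" unfolding k by (rule mult_dvd_mono[OF dvd_refl])
    then show ?case by (subst prod.insert[OF insert.hyps], subst mult.commute)
  qed simp
  from this[OF fin] obtain k where k: "f = (\<Prod>a\<in>?R. [:- a, 1:]) * k" by auto
  let ?p = "\<Prod>a\<in>?R. [:- a, 1:]"
  have "poly k z \<noteq> 0" for z
  proof
    assume kz: "poly k z = 0"
    have "poly ?p z = 0" if "poly f z = 0" using fin that by (simp add: poly_prod prod_zero_iff)
    moreover have fz: "poly f z = 0" using k kz by (metis mult_zero_right poly_mult)
    ultimately have "order z ?p \<noteq> 0" "order z k \<noteq> 0" using k f kz by (metis mult_eq_0_iff order_root)+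
    moreover have "order z f = order z ?p + order z k" using k f order_mult by metis
    ultimately show False using sep[OF fz] by simp
  qed
  then have "degree k = 0" using closed[of k] by (metis One_nat_def Suc_leI not_gr_zero)
  then obtain c where c: "k = [:c:]" by (metis degree_eq_zeroE)
  have monic: "lead_coeff ?p = 1" by (rule trans[OF lead_coeff_prod]) simp
  have deg: "degree ?p = card ?R" by (subst degree_prod_eq_sum_degree) auto
  have fc: "f = smult c ?p" using k c by simp
  then have "lead_coeff f = c" using monic by (metis lead_coeff_smult mult.right_neutral)
  then show "f = smult (lead_coeff f) ?p" using fc by simp
  have "c \<noteq> 0" using fc f by auto
  then show "card ?R = degree f" using deg fc by (metis degree_smult_eq)
qed

section \<open>Isomorphisms of hyperelliptic function fields\<close>

lemma ring_map_const_fract: "ring_map (\<lambda>c :: 'a::field. to_fract [:c:])"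
  by unfold_locales (simp_all flip: one_pCons to_fract_add to_fract_mult)

lemma to_fract_2: "to_fract (2 :: 'r::idom) = 2"
  by (metis one_add_one to_fract_1 to_fract_add)

lemma two_neq_0_fract: "(2::'a::field) \<noteq> 0 \<Longrightarrow> (2 :: 'a poly fract) \<noteq> 0"
  by (metis numeral_poly pCons_eq_0_iff to_fract_2 to_fract_eq_0_iff)

text \<open>One Horner step of division with remainder: multiplying \<open>p0 + p1 Y\<close> by
  \<open>Y\<close> and substituting \<open>Y^2 = - t Y - n\<close>.\<close>

lemma pCons_mod_monic_quadratic:
  fixes n t k p0 p1 :: "'r::comm_ring_1"
  shows "pCons k ([:n, t, 1:] * q + [:p0, p1:]) =
    [:n, t, 1:] * (pCons 0 q + [:p1:]) + [:k - p1 * n, p0 - t * p1:]"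
proof -
  have "[:n, t, 1:] * (pCons 0 q + [:p1:]) = pCons 0 ([:n, t, 1:] * q) + [:p1 * n, p1 * t, p1:]"
    by (simp only: distrib_left mult_pCons_right) simp
  moreover have "pCons k (Y + [:p0, p1:]) = pCons 0 Y + [:p1 * n, p1 * t, p1:] + [:k - p1 * n, p0 - t * p1:]" for Y
    by (cases Y) (simp add: mult.commute)
  ultimately show ?thesis by (simp only:)
qed

text \<open>The same Horner step for \<open>u = r + s y\<close> with \<open>y^2 = F\<close>, read
  off in both components. Here \<open>n\<close> is the norm of \<open>u\<close> and \<open>t\<close>
  minus its trace, whence \<open>- - 2 * r\<close>.\<close>

lemma monic_quadratic_product:
  fixes r s k F p0 p1 :: "'r::comm_ring_1"
  shows "k + (r * (p1 * r + p0) + s * (p1 * s) * F) =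
      (p0 - - 2 * r * p1) * r + (k - p1 * (r\<^sup>2 - s\<^sup>2 * F))"
    and "r * (p1 * s) + s * (p1 * r + p0) = (p0 - - 2 * r * p1) * s"
  by (simp_all add: algebra_simps power2_eq_square)

locale function_field_iso =
  fixes f1 f2 :: "'a::field poly" and \<phi> :: "'a ffield \<Rightarrow> 'a ffield"
  assumes bij: "bij \<phi>"
    and add: "\<phi> (ff_add a b) = ff_add (\<phi> a) (\<phi> b)"
    and mult: "\<phi> (ff_mult f1 a b) = ff_mult f2 (\<phi> a) (\<phi> b)"
    and const: "\<phi> (ff_const c) = ff_const c"
    and two: "(2::'a) \<noteq> 0"
begin

abbreviation (input) "X \<equiv> to_fract [:0, 1 :: 'a:]"
abbreviation (input) "K \<equiv> (\<lambda>c :: 'a. to_fract [:c:])"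

lemma zero: "\<phi> (0, 0) = (0, 0)"
  using const[of 0] by (simp add: ff_const_def flip: to_fract_def)

lemma image_pCons: "\<phi> (to_fract (pCons c p), 0) = ff_add (K c, 0) (ff_mult f2 (\<phi> (X, 0)) (\<phi> (to_fract p, 0)))"
proof -
  have "pCons c p = [:c:] + [:0, 1:] * p" by simp
  then have "(to_fract (pCons c p), 0) = ff_add (ff_const c) (ff_mult f1 (X, 0) (to_fract p, 0))"
    by (simp add: ff_add_def ff_mult_def ff_const_def flip: to_fract_def to_fract_add to_fract_mult)
  then show ?thesis
    by (simp only: add mult const) (simp add: ff_const_def flip: to_fract_def)
qed

text \<open>The image of \<open>p\<close> is \<open>p(u)\<close> for \<open>u = r + s y\<close>, so
  it depends only on the remainder of \<open>p\<close> modulo the characteristic polynomial of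
  \<open>u\<close> over \<open>K(x)\<close>.\<close>

lemma eval_mod_min_poly:
  assumes u: "\<phi> (X, 0) = (r, s)"
  shows "\<exists>q p0 p1. map_poly K p = [:r\<^sup>2 - s\<^sup>2 * to_fract f2, - 2 * r, 1:] * q + [:p0, p1:] \<and>
    \<phi> (to_fract p, 0) = (p1 * r + p0, p1 * s)"
proof (induction p)
  case 0
  show ?case by (rule exI[of _ 0], rule exI[of _ 0], rule exI[of _ 0]) (simp add: zero)
next
  case (pCons c p)
  let ?G = "[:r\<^sup>2 - s\<^sup>2 * to_fract f2, - 2 * r, 1:]"
  obtain q p0 p1 where IH: "map_poly K p = ?G * q + [:p0, p1:]"
    "\<phi> (to_fract p, 0) = (p1 * r + p0, p1 * s)"
    using pCons.IH by blast
  let ?p0 = "K c - p1 * (r\<^sup>2 - s\<^sup>2 * to_fract f2)" and ?p1 = "p0 - - 2 * r * p1"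
  have "map_poly K (pCons c p) = pCons (K c) (?G * q + [:p0, p1:])"
    unfolding IH(1)[symmetric] by (rule map_poly_pCons) simp
  also have "\<dots> = ?G * (pCons 0 q + [:p1:]) + [:?p0, ?p1:]"
    by (rule pCons_mod_monic_quadratic)
  finally have 1: "map_poly K (pCons c p) = ?G * (pCons 0 q + [:p1:]) + [:?p0, ?p1:]" .
  have 2: "\<phi> (to_fract (pCons c p), 0) = (?p1 * r + ?p0, ?p1 * s)"
    unfolding image_pCons[of c p] u IH(2)
       ff_add_def ff_mult_def fst_conv snd_conv to_fract_def[symmetric] by (simp only: add_0_left monic_quadratic_product)
  show ?case
    by (rule exI[of _ "pCons 0 q + [:p1:]"], rule exI[of _ ?p0], rule exI[of _ ?p1], rule conjI[OF 1 2])
qed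

section \<open>The relation of bidegree (2, 2) between \<open>x\<close> and its image\<close>

lemma X_preimage:
  obtains P Q S where "Q \<noteq> 0" "\<phi> (to_fract P / to_fract Q, to_fract S / to_fract Q) = (X, 0)"
proof -
  obtain \<alpha> \<beta> where ab: "\<phi> (\<alpha>, \<beta>) = (X, 0)" using bij by (metis bij_pointE surj_pair)
  obtain n d where nd: "d \<noteq> 0" "\<alpha> = to_fract n / to_fract d" by (rule fract_eq_quotient)
  obtain n' d' where nd': "d' \<noteq> 0" "\<beta> = to_fract n' / to_fract d'" by (rule fract_eq_quotient)
  have "\<alpha> = to_fract (n * d') / to_fract (d * d')" "\<beta> = to_fract (n' * d) / to_fract (d * d')"
    using nd nd' by simp_all
  then show ?thesis using that[of "d * d'" "n * d'" "n' * d"] nd nd' ab by simp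
qed

lemma quadratic_relation:
  assumes u: "\<phi> (X, 0) = (r, s)" and s: "s \<noteq> 0"
  obtains E where "E \<noteq> 0" "\<And>i. degree (coeff E i) \<le> 2"
    "[:r\<^sup>2 - s\<^sup>2 * to_fract f2, - 2 * r, 1:] dvd map_poly to_fract E"
proof -
  let ?G = "[:r\<^sup>2 - s\<^sup>2 * to_fract f2, - 2 * r, 1:]"
  obtain P Q S where Q: "Q \<noteq> 0" and pre: "\<phi> (to_fract P / to_fract Q, to_fract S / to_fract Q) = (X, 0)"
    by (rule X_preimage)
  let ?\<zeta> = "(to_fract P / to_fract Q, to_fract S / to_fract Q)"
  define a b c where "a = Q\<^sup>2" and "b = - 2 * P * Q" and "c = P\<^sup>2 - S\<^sup>2 * f1"
  have "to_fract Q \<noteq> 0" using Q by simp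
  then have rel1: "ff_add (ff_mult f1 (to_fract a, 0) (ff_mult f1 ?\<zeta> ?\<zeta>))
      (ff_add (ff_mult f1 (to_fract b, 0) ?\<zeta>) (to_fract c, 0)) = (0, 0)"
    unfolding a_def b_def c_def ff_add_def ff_mult_def
    by (simp add: to_fract_2 field_simps power2_eq_square flip: to_fract_def)
  have rel: "ff_add (ff_mult f2 (\<phi> (to_fract a, 0)) (ff_mult f2 (X, 0) (X, 0)))
      (ff_add (ff_mult f2 (\<phi> (to_fract b, 0)) (X, 0)) (\<phi> (to_fract c, 0))) = (0, 0)"
    using arg_cong[OF rel1, of \<phi>] by (simp only: add mult pre zero)
  obtain qa a0 a1 where A: "map_poly K a = ?G * qa + [:a0, a1:]" "\<phi> (to_fract a, 0) = (a1 * r + a0, a1 * s)"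
    using eval_mod_min_poly[OF u, of a] by (elim exE conjE)
  obtain qb b0 b1 where B: "map_poly K b = ?G * qb + [:b0, b1:]" "\<phi> (to_fract b, 0) = (b1 * r + b0, b1 * s)"
    using eval_mod_min_poly[OF u, of b] by (elim exE conjE)
  obtain qc c0 c1 where C: "map_poly K c = ?G * qc + [:c0, c1:]" "\<phi> (to_fract c, 0) = (c1 * r + c0, c1 * s)"
    using eval_mod_min_poly[OF u, of c] by (elim exE conjE)
  have "(a1 * r + a0) * (X * X) + ((b1 * r + b0) * X + (c1 * r + c0)) = 0"
    and "a1 * s * (X * X) + (b1 * s * X + c1 * s) = 0"
    using rel unfolding A(2) B(2) C(2) ff_add_def ff_mult_def fst_conv snd_conv prod.inject
    by (simp_all only: mult_zero_right mult_zero_left add_0_right add_0_left)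
  \<comment> \<open>The equation says that a linear polynomial over \<open>K(x)\<close> vanishes at
    \<open>u = r + s y\<close>. Since \<open>s\<close> is nonzero, 1 and \<open>u\<close> are
    independent over \<open>K(x)\<close>, so both coefficients vanish.\<close>
  then have "s * (X\<^sup>2 * a1 + X * b1 + c1) = 0"
    and fst: "(X\<^sup>2 * a1 + X * b1 + c1) * r + (X\<^sup>2 * a0 + X * b0 + c0) = 0"
    by (simp_all only: algebra_simps power2_eq_square)
  then have e1: "X\<^sup>2 * a1 + X * b1 + c1 = 0" using s by simp
  then have e0: "X\<^sup>2 * a0 + X * b0 + c0 = 0" using fst by simp
  \<comment> \<open>The outer variable of \<open>E\<close> stands for \<open>u\<close> and the inner
    one for \<open>x\<close>, so the coefficients of \<open>E\<close> are quadratic in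
    \<open>x\<close>.\<close>
  define E where "E = smult ([:0, 1:]\<^sup>2) (map_poly (\<lambda>c. [:c:]) a)
    + smult [:0, 1:] (map_poly (\<lambda>c. [:c:]) b) + map_poly (\<lambda>c. [:c:]) c"
  have coeffE: "coeff E i = [:coeff c i, coeff b i, coeff a i:]" for i
    unfolding E_def by (simp add: coeff_map_poly power2_eq_square)
  have "a \<noteq> 0" unfolding a_def using Q by simp
  then have "coeff E (degree a) \<noteq> 0" by (simp add: coeffE)
  then have "E \<noteq> 0" by auto
  interpret fr: ring_map "map_poly (to_fract :: 'a poly \<Rightarrow> _)"
    by (rule ring_map.ring_map_map_poly[OF ring_map_to_fract])
  have K: "map_poly to_fract (map_poly (\<lambda>c. [:c:]) p) = map_poly K p" for p :: "'a poly"
    by (simp add: map_poly_map_poly o_def)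
  have "map_poly to_fract E = smult (X\<^sup>2) (map_poly K a) + smult X (map_poly K b) + map_poly K c"
    unfolding E_def fr.hom_add ring_map.map_poly_hom_smult[OF ring_map_to_fract] K
      ring_map.hom_power[OF ring_map_to_fract] ..
  also have "\<dots> = ?G * (smult (X\<^sup>2) qa + smult X qb + qc)
      + [:X\<^sup>2 * a0 + X * b0 + c0, X\<^sup>2 * a1 + X * b1 + c1:]"
    unfolding A(1) B(1) C(1) by (simp only: distrib_left mult_smult_right smult_add_right) simp
  also have "\<dots> = ?G * (smult (X\<^sup>2) qa + smult X qb + qc)"
    unfolding e0 e1 by simp
  finally have "?G dvd map_poly to_fract E" by (rule dvdI)
  then show ?thesis using that \<open>E \<noteq> 0\<close> coeffE by (simp add: degree_pCons_le numeral_2_eq_2)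
qed

end

locale embedded_function_field_iso = function_field_iso f1 f2 \<phi>
  for f1 f2 :: "'a::field poly" and \<phi> +
  fixes \<iota> :: "'a \<Rightarrow> 'b::field"
  assumes closed: "\<And>p :: 'b poly. degree p \<ge> 1 \<Longrightarrow> \<exists>z. poly p z = 0"
    and inf: "infinite (UNIV :: 'b set)" and emb: "field_embedding \<iota>"
    and sep1: "separable_poly \<iota> f1" and sep2: "separable_poly \<iota> f2" and deg5: "degree f2 \<ge> 5"
begin

sublocale \<iota>: ring_map \<iota> by (rule ring_map_field_embedding[OF emb])
sublocale \<iota>p: ring_map "map_poly \<iota>" by (rule \<iota>.ring_map_map_poly)

lemma inj_iota: "inj \<iota>" using emb unfolding field_embedding_def by blast

lemma map_iota_eq_0: "map_poly \<iota> p = 0 \<longleftrightarrow> p = 0"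
  using map_poly_inject[OF inj_iota \<iota>.hom_0, of p 0] by simp

lemma separable_map_iota:
  assumes "separable_poly \<iota> f"
  shows "map_poly \<iota> f \<noteq> 0" "poly (map_poly \<iota> f) z = 0 \<Longrightarrow> order z (map_poly \<iota> f) = 1"
  using assms by (auto simp: separable_poly_def map_iota_eq_0)

lemma card_roots_of:
  assumes "separable_poly \<iota> f"
  shows "card (roots_of \<iota> f) = degree f"
proof -
  have "degree (map_poly \<iota> f) = degree f"
    using separable_map_iota(1)[OF assms] inj_eq[OF inj_iota, of _ 0]
    by (intro map_poly_degree_eq) (auto simp: map_iota_eq_0 \<iota>.hom_0)
  then show ?thesis
    using separable_factorization(2)[OF closed separable_map_iota[OF assms]] by (simp add: roots_of_def)
qed

lemma image_X_rational:
  assumes u: "\<phi> (to_fract [:0, 1:], 0) = (r, s)"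
  shows "s = 0"
proof (rule ccontr)
  assume s: "s \<noteq> 0"
  let ?G0 = "[:r\<^sup>2 - s\<^sup>2 * to_fract f2, - 2 * r, 1:]"
  obtain E where E: "E \<noteq> 0" "\<And>i. degree (coeff E i) \<le> 2" "?G0 dvd map_poly to_fract E"
    using quadratic_relation[OF u s] by blast
  obtain A G g G' where G: "A \<noteq> 0" "smult (to_fract A) ?G0 = map_poly to_fract G" "g \<noteq> 0"
    "map_poly (map_poly \<iota>) G = smult g G'" "primitive_coeffs G'" "\<And>i. degree (coeff G' i) \<le> 2"
    using primitive_factor_degree_le[OF closed inf emb E(3,1,2)] by blast
  have Gi: "to_fract (coeff G i) = to_fract A * coeff ?G0 i" for i
    using arg_cong[OF G(2), of "\<lambda>p. coeff p i"] by (simp add: coeff_map_poly del: smult_pCons)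
  have G'i: "map_poly \<iota> (coeff G i) = g * coeff G' i" for i
    using arg_cong[OF G(4), of "\<lambda>p. coeff p i"] by (simp add: coeff_map_poly)
  obtain s1 s2 where s12: "s2 \<noteq> 0" "s = to_fract s1 / to_fract s2" by (rule fract_eq_quotient)
  have s1: "s1 \<noteq> 0" using s s12 by auto
  \<comment> \<open>The discriminant of \<open>A\<close> times the quadratic is
    \<open>(2 A s)^2 f2\<close>. Removing the content \<open>g\<close> divides it by
    \<open>g^2\<close>, which leaves \<open>D'\<close> of degree at most 4, still equal to
    \<open>f2\<close> up to squares.\<close>
  define D where "D = (coeff G 1)\<^sup>2 - 4 * coeff G 0 * coeff G 2"
  define D' where "D' = (coeff G' 1)\<^sup>2 - 4 * coeff G' 0 * coeff G' 2"
  have four: "to_fract (4 :: 'a poly) = 4"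
    by (metis numeral_Bit0 numeral_One to_fract_1 to_fract_add)
  have "to_fract D = (to_fract A * (- 2 * r))\<^sup>2 - 4 * (to_fract A * (r\<^sup>2 - s\<^sup>2 * to_fract f2)) * to_fract A"
    unfolding D_def by (simp add: power2_eq_square four Gi numeral_2_eq_2)
  also have "\<dots> = (2 * to_fract A * s)\<^sup>2 * to_fract f2"
    by (simp add: algebra_simps power2_eq_square)
  finally have "(to_fract s2)\<^sup>2 * to_fract D = (to_fract s2)\<^sup>2 * ((2 * to_fract A * s)\<^sup>2 * to_fract f2)"
    by simp
  also have "\<dots> = (2 * to_fract A * to_fract s1)\<^sup>2 * to_fract f2"
    using s12 by (simp add: power2_eq_square)
  finally have "to_fract (s2\<^sup>2 * D) = to_fract ((2 * A * s1)\<^sup>2 * f2)"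
    by (simp add: power2_eq_square to_fract_2 four)
  then have "s2\<^sup>2 * D = (2 * A * s1)\<^sup>2 * f2" by (simp only: to_fract_eq_iff)
  from arg_cong[OF this, of "map_poly \<iota>"]
  have "(map_poly \<iota> (2 * A * s1))\<^sup>2 * map_poly \<iota> f2 = (map_poly \<iota> s2)\<^sup>2 * map_poly \<iota> D"
    by (simp only: \<iota>p.hom_mult \<iota>p.hom_power)
  also have "map_poly \<iota> D = g\<^sup>2 * D'"
  proof -
    have "map_poly \<iota> 4 = (4 :: 'b poly)"
      by (metis \<iota>p.hom_1 \<iota>p.hom_add numeral_Bit0 numeral_One)
    then show ?thesis
      unfolding D_def D'_def \<iota>p.hom_diff \<iota>p.hom_mult \<iota>p.hom_power G'i
      by (simp add: algebra_simps power2_eq_square)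
  qed
  finally have eq: "(map_poly \<iota> (2 * A * s1))\<^sup>2 * map_poly \<iota> f2 = (map_poly \<iota> s2 * g)\<^sup>2 * D'"
    by (simp add: power_mult_distrib mult.assoc)
  have "(2 :: 'a poly) \<noteq> 0" using two by (simp add: numeral_poly)
  then have nz: "map_poly \<iota> (2 * A * s1) \<noteq> 0" using G(1) s1 by (simp add: map_iota_eq_0)
  note f2 = separable_map_iota[OF sep2]
  note par = order_parity[OF eq nz f2(1)]
  have "{z. poly (map_poly \<iota> f2) z = 0} \<subseteq> {z. poly D' z = 0}"
  proof safe
    fix z assume "poly (map_poly \<iota> f2) z = 0"
    then have "odd (order z D')" using par(3)[of z] f2(2) by simp
    then show "poly D' z = 0" using order_root[of D' z] by (auto elim: oddE)
  qed
  then have "card {z. poly (map_poly \<iota> f2) z = 0} \<le> card {z. poly D' z = 0}"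
    using poly_roots_finite[OF par(2)] by (rule card_mono[rotated])
  also have "\<dots> \<le> degree D'" using card_poly_roots_bound[OF par(2)] .
  also have "\<dots> \<le> 4"
  proof -
    have "degree ((coeff G' 1)\<^sup>2) \<le> 4"
      using degree_power_le[of "coeff G' 1" 2] G(6)[of 1] by simp
    moreover have "degree (4 * coeff G' 0 * coeff G' 2) \<le> 4"
      using degree_mult_le[of "4 * coeff G' 0" "coeff G' 2"] degree_mult_le[of 4 "coeff G' 0"]
        G(6)[of 0] G(6)[of 2] by simp
    ultimately show ?thesis unfolding D'_def by (rule degree_diff_le)
  qed
  finally have "card {z. poly (map_poly \<iota> f2) z = 0} \<le> 4" .
  then show False
    using card_roots_of[OF sep2] deg5 by (simp add: roots_of_def)
qed

end

text \<open>The zeros of the member at \<open>a\<close> are the points where \<open>R / S\<close>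
  takes the value \<open>a\<close>, for coprime \<open>R\<close> and \<open>S\<close>; at infinity
  only finite poles are seen.\<close>

definition pencil :: "'b::field poly \<Rightarrow> 'b poly \<Rightarrow> 'b option \<Rightarrow> 'b poly" where
  "pencil R S a = (case a of None \<Rightarrow> S | Some c \<Rightarrow> R - smult c S)"

context embedded_function_field_iso
begin

section \<open>The image of \<open>x\<close> as a linear fractional function\<close>

lemma image_poly:
  assumes u: "\<phi> (X, 0) = (r, 0)"
  shows "\<phi> (to_fract p, 0) = (poly (map_poly K p) r, 0)"
proof (induction p)
  case 0
  show ?case by (simp add: zero)
next
  case (pCons c p)
  show ?case
    unfolding image_pCons[of c p] u pCons.IH by (simp add: ff_add_def ff_mult_def map_poly_pCons)
qed

lemma image_quotient:
  assumes u: "\<phi> (X, 0) = (r, 0)" and Q: "Q \<noteq> 0"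
  shows "poly (map_poly K Q) r \<noteq> 0"
    and "\<phi> (to_fract P / to_fract Q, 0) = (poly (map_poly K P) r / poly (map_poly K Q) r, 0)"
proof -
  have "\<phi> (to_fract Q, 0) \<noteq> \<phi> (0, 0)" using bij Q by (auto simp: bij_def inj_eq)
  then show Q': "poly (map_poly K Q) r \<noteq> 0" by (simp add: image_poly[OF u] zero)
  obtain x y where xy: "\<phi> (to_fract P / to_fract Q, 0) = (x, y)" by fastforce
  have "(to_fract P, 0) = ff_mult f1 (to_fract Q, 0) (to_fract P / to_fract Q, 0)"
    using Q by (simp add: ff_mult_def)
  then have "\<phi> (to_fract P, 0) = ff_mult f2 (\<phi> (to_fract Q, 0)) (x, y)"
    unfolding xy[symmetric] by (simp only: mult)
  then show "\<phi> (to_fract P / to_fract Q, 0) = (poly (map_poly K P) r / poly (map_poly K Q) r, 0)"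
    using Q' by (simp add: image_poly[OF u] ff_mult_def xy field_simps)
qed

lemma image_decompose: "\<phi> (\<alpha>, \<beta>) = ff_add (\<phi> (\<alpha>, 0)) (ff_mult f2 (\<phi> (\<beta>, 0)) (\<phi> (0, 1)))"
proof -
  have "(\<alpha>, \<beta>) = ff_add (\<alpha>, 0) (ff_mult f1 (\<beta>, 0) (0, 1))" by (simp add: ff_add_def ff_mult_def)
  then show ?thesis by (metis add mult)
qed

text \<open>With \<open>u\<close> in \<open>K(x)\<close>, all of \<open>K(x)\<close> is mapped into
  \<open>K(x)\<close>. So the image \<open>p + q y\<close> of \<open>y\<close> has \<open>q\<close>
  nonzero by surjectivity, and as its square lies in \<open>K(x)\<close> and 2 is invertible,
  \<open>p = 0\<close>. The preimage of \<open>x\<close> then expresses \<open>x\<close> as a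
  quotient of polynomials in \<open>r\<close>.\<close>

lemma image_generators:
  obtains r q P Q where "\<phi> (X, 0) = (r, 0)" "q \<noteq> 0"
    "q\<^sup>2 * to_fract f2 = poly (map_poly K f1) r" "Q \<noteq> 0"
    "X * poly (map_poly K Q) r = poly (map_poly K P) r"
proof -
  obtain r s where "\<phi> (X, 0) = (r, s)" by fastforce
  then have u: "\<phi> (X, 0) = (r, 0)" using image_X_rational by blast
  obtain p q where y: "\<phi> (0, 1) = (p, q)" by fastforce
  have rat: "snd (\<phi> (\<beta>, 0)) = 0" for \<beta>
  proof -
    obtain n d where nd: "d \<noteq> 0" "\<beta> = to_fract n / to_fract d" by (rule fract_eq_quotient)
    show ?thesis unfolding nd(2) image_quotient(2)[OF u nd(1)] by simp
  qed
  have q: "q \<noteq> 0"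
  proof
    assume q0: "q = 0"
    obtain \<alpha> \<beta> where "\<phi> (\<alpha>, \<beta>) = (0, 1)" using bij by (metis bij_pointE surj_pair)
    then have "snd (ff_add (\<phi> (\<alpha>, 0)) (ff_mult f2 (\<phi> (\<beta>, 0)) (p, q))) = 1"
      using image_decompose[of \<alpha> \<beta>] y by simp
    then show False by (simp add: ff_add_def ff_mult_def rat q0)
  qed
  have "ff_mult f1 (0, 1) (0, 1) = (to_fract f1, 0)" by (simp add: ff_mult_def flip: to_fract_def)
  then have "ff_mult f2 (p, q) (p, q) = (poly (map_poly K f1) r, 0)"
    by (metis image_poly[OF u] mult y)
  then have sq: "p * p + q * q * to_fract f2 = poly (map_poly K f1) r" and "2 * (p * q) = 0"
    by (simp_all add: ff_mult_def mult.commute flip: to_fract_def)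
  then have p: "p = 0" using q two_neq_0_fract[OF two] by simp
  obtain P Q S where Q: "Q \<noteq> 0" and pre: "\<phi> (to_fract P / to_fract Q, to_fract S / to_fract Q) = (X, 0)"
    by (rule X_preimage)
  have "X = poly (map_poly K P) r / poly (map_poly K Q) r"
    using pre unfolding image_decompose[of "to_fract P / to_fract Q"] y p image_quotient(2)[OF u Q]
    by (simp add: ff_add_def ff_mult_def)
  then have "X * poly (map_poly K Q) r = poly (map_poly K P) r"
    using image_quotient(1)[OF u Q] by simp
  then show ?thesis using that[OF u q _ Q] sq p by (simp add: power2_eq_square)
qed

text \<open>From \<open>x Q(r) = P(r)\<close>, \<open>r\<close> is a root of a polynomial whose
  coefficients are linear in \<open>x\<close>. The degree bound for the primitive multiple of
  \<open>Y - r\<close> makes numerator and denominator linear.\<close>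

lemma image_linear_fractional:
  obtains q r A R0 g R S where "q \<noteq> 0" "q\<^sup>2 * to_fract f2 = poly (map_poly K f1) r"
    "A \<noteq> 0" "r = to_fract R0 / to_fract A" "g \<noteq> 0" "map_poly \<iota> R0 = g * R" "map_poly \<iota> A = g * S"
    "degree R \<le> 1" "degree S \<le> 1" "\<forall>z. poly R z \<noteq> 0 \<or> poly S z \<noteq> 0"
proof -
  obtain r q P Q where q: "q \<noteq> 0" "q\<^sup>2 * to_fract f2 = poly (map_poly K f1) r" and Q: "Q \<noteq> 0"
    and X: "X * poly (map_poly K Q) r = poly (map_poly K P) r"
    by (rule image_generators)
  define E where "E = smult [:0, 1:] (map_poly (\<lambda>c. [:c:]) Q) + map_poly (\<lambda>c. [:c:]) (- P)"
  have coeffE: "coeff E i = [:- coeff P i, coeff Q i:]" for i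
    unfolding E_def by (simp add: coeff_map_poly)
  have "coeff E (degree Q) \<noteq> 0" using Q by (simp add: coeffE)
  then have E0: "E \<noteq> 0" by auto
  interpret fr: ring_map "map_poly (to_fract :: 'a poly \<Rightarrow> _)"
    by (rule ring_map.ring_map_map_poly[OF ring_map_to_fract])
  interpret K: ring_map "map_poly (\<lambda>c :: 'a. to_fract [:c:])"
    by (rule ring_map.ring_map_map_poly[OF ring_map_const_fract])
  have "map_poly to_fract E = smult (X) (map_poly K Q)
      + map_poly K (- P)"
    unfolding E_def fr.hom_add ring_map.map_poly_hom_smult[OF ring_map_to_fract]
    by (simp add: map_poly_map_poly o_def)
  then have "poly (map_poly to_fract E) r = 0" using X by (simp add: K.hom_uminus)
  then have dvd: "[:- r, 1:] dvd map_poly to_fract E" by (simp add: poly_eq_0_iff_dvd)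
  have "degree (coeff E i) \<le> 1" for i by (simp add: coeffE)
  then obtain A G g G' where G: "A \<noteq> 0" "smult (to_fract A) [:- r, 1:] = map_poly to_fract G" "g \<noteq> 0"
    "map_poly (map_poly \<iota>) G = smult g G'" "primitive_coeffs G'" "\<And>i. degree (coeff G' i) \<le> 1"
    using primitive_factor_degree_le[OF closed inf emb dvd E0] by blast
  have Gi: "to_fract (coeff G i) = to_fract A * coeff [:- r, 1:] i" for i
    using arg_cong[OF G(2), of "\<lambda>p. coeff p i"] by (simp add: coeff_map_poly del: smult_pCons)
  have G'i: "map_poly \<iota> (coeff G i) = g * coeff G' i" for i
    using arg_cong[OF G(4), of "\<lambda>p. coeff p i"] by (simp add: coeff_map_poly)
  have G1: "coeff G 1 = A" using Gi[of 1] by simp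
  have r: "r = to_fract (- coeff G 0) / to_fract A" using Gi[of 0] G(1) by simp
  have Gz: "coeff G' i = 0" if "i \<ge> 2" for i
  proof -
    have "coeff [:- r, 1:] i = 0" using that by (intro coeff_eq_0) simp
    then have "coeff G i = 0" using Gi[of i] by simp
    then show ?thesis using G'i[of i] G(3) by simp
  qed
  have prim: "poly (- coeff G' 0) z \<noteq> 0 \<or> poly (coeff G' 1) z \<noteq> 0" for z
  proof -
    obtain i where i: "poly (coeff G' i) z \<noteq> 0" using G(5) unfolding primitive_coeffs_def by blast
    then have "i = 0 \<or> i = 1" using Gz[of i] by (cases "i \<ge> 2") auto
    then show ?thesis using i by auto
  qed
  show ?thesis
    by (rule that[OF q G(1) r G(3), of "- coeff G' 0" "coeff G' 1"])
      (use prim G(6)[of 0] G(6)[of 1] G'i[of 0] G'i[of 1] G1 in \<open>auto simp: \<iota>p.hom_uminus\<close>)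
qed

text \<open>Multiplying \<open>f1(R / S)\<close> by a power of \<open>S\<close> turns each root
  \<open>a\<close> of \<open>f1\<close> into the factor \<open>R - a S\<close>; up to squares, the
  product is \<open>f2\<close>.\<close>

lemma branch_identity:
  obtains R S P Q c where "degree R \<le> 1" "degree S \<le> 1" "\<forall>z. poly R z \<noteq> 0 \<or> poly S z \<noteq> 0" "P \<noteq> 0"
    "P\<^sup>2 * map_poly \<iota> f2 = Q\<^sup>2 * smult c (\<Prod>a\<in>branch_points (roots_of \<iota> f1). pencil R S a)"
proof -
  obtain q r A R0 g R S where q: "q \<noteq> 0" "q\<^sup>2 * to_fract f2 = poly (map_poly K f1) r"
    and A: "A \<noteq> 0" "r = to_fract R0 / to_fract A" "g \<noteq> 0" "map_poly \<iota> R0 = g * R" "map_poly \<iota> A = g * S"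
    and RS: "degree R \<le> 1" "degree S \<le> 1" "\<forall>z. poly R z \<noteq> 0 \<or> poly S z \<noteq> 0"
    by (rule image_linear_fractional)
  obtain q1 q2 where q12: "q2 \<noteq> 0" "q = to_fract q1 / to_fract q2" by (rule fract_eq_quotient)
  have q1: "q1 \<noteq> 0" using q(1) q12 by auto
  define n where "n = degree f1"
  have fz: "to_fract A ^ n * poly (map_poly K f1) r
      = to_fract (\<Sum>i\<le>n. smult (coeff f1 i) (R0 ^ i * A ^ (n - i)))"
  proof -
    have "degree (map_poly K f1) = n"
      unfolding n_def by (cases "f1 = 0") (auto intro: map_poly_degree_eq)
    then have "poly (map_poly K f1) r = (\<Sum>i\<le>n. to_fract [:coeff f1 i:] * r ^ i)"
      by (simp add: poly_altdef coeff_map_poly)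
    moreover have "to_fract A ^ n * (to_fract [:c:] * r ^ i) = to_fract (smult c (R0 ^ i * A ^ (n - i)))"
      if "i \<le> n" for i c
    proof -
      have 1: "to_fract A ^ n = to_fract A ^ i * to_fract A ^ (n - i)"
        using that by (simp flip: power_add)
      have 2: "to_fract R0 ^ i = to_fract A ^ i * r ^ i"
        using A by (simp flip: power_mult_distrib)
      have 3: "smult c (R0 ^ i * A ^ (n - i)) = [:c:] * (R0 ^ i * A ^ (n - i))" by simp
      show ?thesis
        unfolding 3 to_fract_mult ring_map.hom_power[OF ring_map_to_fract] 1 2 by (simp only: mult_ac)
    qed
    ultimately show ?thesis by (simp add: sum_distrib_left)
  qed
  let ?H = "\<Sum>i\<le>n. smult (coeff f1 i) (R0 ^ i * A ^ (n - i))"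
  have "to_fract (q1\<^sup>2 * f2 * A ^ n) = (to_fract q2)\<^sup>2 * (to_fract A ^ n * (q\<^sup>2 * to_fract f2))"
    using q12 by (simp add: ring_map.hom_power[OF ring_map_to_fract] power_divide)
  also have "\<dots> = to_fract (q2\<^sup>2 * ?H)"
    unfolding q(2) fz by (simp add: ring_map.hom_power[OF ring_map_to_fract])
  finally have eq: "q1\<^sup>2 * f2 * A ^ n = q2\<^sup>2 * ?H" by (simp only: to_fract_eq_iff)
  let ?f1 = "map_poly \<iota> f1" and ?q1 = "map_poly \<iota> q1" and ?q2 = "map_poly \<iota> q2"
  have eq': "?q1\<^sup>2 * map_poly \<iota> f2 * (g * S) ^ n =
      ?q2\<^sup>2 * (\<Sum>i\<le>n. smult (\<iota> (coeff f1 i)) ((g * R) ^ i * (g * S) ^ (n - i)))"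
    using arg_cong[OF eq, of "map_poly \<iota>"]
    by (simp only: \<iota>p.hom_mult \<iota>p.hom_power \<iota>p.hom_sum \<iota>.map_poly_hom_smult A(4,5))
  let ?R1 = "roots_of \<iota> f1"
  note sf1 = separable_map_iota[OF sep1]
  define c where "c = lead_coeff ?f1"
  have fact: "?f1 = smult c (\<Prod>a\<in>?R1. [:- a, 1:])"
    using separable_factorization(1)[OF closed sf1] unfolding c_def roots_of_def .
  have cR1: "card ?R1 = n" unfolding n_def by (rule card_roots_of[OF sep1])
  have S0: "S \<noteq> 0" using A(1,5) map_iota_eq_0[of A] by auto
  let ?T = "\<Prod>a\<in>?R1. pencil R S (Some a)"
  \<comment> \<open>The identity is checked pointwise: times \<open>g * S\<close>, the difference
    vanishes at every point of an infinite field.\<close>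
  define W where "W = ?q1\<^sup>2 * map_poly \<iota> f2 * S ^ n - ?q2\<^sup>2 * smult c ?T"
  have "poly (W * (g * S)) z = 0" for z
  proof (cases "poly (g * S) z = 0")
    case False
    let ?y = "poly R z / poly S z"
    have gS: "poly g z \<noteq> 0" "poly S z \<noteq> 0" using False by auto
    have y: "poly g z * poly R z = (poly g z * poly S z) * ?y" using gS by simp
    have "poly (?q1\<^sup>2 * map_poly \<iota> f2) z * (poly g z * poly S z) ^ n =
        (poly ?q2 z)\<^sup>2 * (\<Sum>i\<le>n. \<iota> (coeff f1 i) * ((poly g z * poly R z) ^ i * (poly g z * poly S z) ^ (n - i)))"
      using arg_cong[OF eq', of "\<lambda>p. poly p z"] by (simp add: poly_sum)
    also have "(\<Sum>i\<le>n. \<iota> (coeff f1 i) * ((poly g z * poly R z) ^ i * (poly g z * poly S z) ^ (n - i)))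
        = (\<Sum>i\<le>n. (poly g z * poly S z) ^ n * (\<iota> (coeff f1 i) * ?y ^ i))"
    proof (intro sum.cong refl)
      fix i assume "i \<in> {..n}"
      then have "(poly g z * poly S z) ^ n = (poly g z * poly S z) ^ i * (poly g z * poly S z) ^ (n - i)"
        by (simp flip: power_add)
      then show "\<iota> (coeff f1 i) * ((poly g z * poly R z) ^ i * (poly g z * poly S z) ^ (n - i)) =
          (poly g z * poly S z) ^ n * (\<iota> (coeff f1 i) * ?y ^ i)"
        unfolding y power_mult_distrib[of "poly g z * poly S z" ?y] by (simp only: mult_ac)
    qed
    also have "\<dots> = (poly g z * poly S z) ^ n * poly ?f1 ?y"
    proof -
      have "degree ?f1 = n" using separable_factorization(2)[OF closed sf1] cR1 by (simp add: roots_of_def)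
      then show ?thesis by (simp add: poly_altdef coeff_map_poly \<iota>.hom_0 sum_distrib_left)
    qed
    finally have "poly (?q1\<^sup>2 * map_poly \<iota> f2) z * (poly g z * poly S z) ^ n =
        ((poly ?q2 z)\<^sup>2 * poly ?f1 ?y) * (poly g z * poly S z) ^ n"
      by (simp only: mult_ac)
    then have 1: "poly (?q1\<^sup>2 * map_poly \<iota> f2) z = (poly ?q2 z)\<^sup>2 * poly ?f1 ?y"
      using gS by (simp only: mult_cancel_right) auto
    have 2: "poly S z ^ n * poly ?f1 ?y = c * poly ?T z"
    proof -
      have "poly S z ^ n * (\<Prod>a\<in>?R1. ?y - a) = (\<Prod>a\<in>?R1. poly S z * (?y - a))"
        by (simp add: prod.distrib cR1)
      also have "\<dots> = poly ?T z"
        using gS by (simp add: poly_prod pencil_def right_diff_distrib mult.commute)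
      finally show ?thesis by (subst fact) (simp add: poly_prod mult.left_commute)
    qed
    have "poly (?q1\<^sup>2 * map_poly \<iota> f2) z * poly S z ^ n = (poly ?q2 z)\<^sup>2 * (c * poly ?T z)"
      unfolding 1 2[symmetric] by (simp only: mult_ac)
    then show ?thesis unfolding W_def by simp
  qed simp
  then have "{z. poly (W * (g * S)) z = 0} = UNIV" by blast
  then have "W * (g * S) = 0"
    using poly_roots_finite[of "W * (g * S)"] inf by (cases "W * (g * S) = 0") simp_all
  then have W: "?q1\<^sup>2 * map_poly \<iota> f2 * S ^ n = ?q2\<^sup>2 * smult c ?T"
    using A(3) S0 unfolding W_def by simp
  have fin: "finite ?R1" unfolding roots_of_def by (rule poly_roots_finite[OF sf1(1)])
  define k where "k = (if odd n then 1 else 0 :: nat)"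
  have "(\<Prod>a\<in>branch_points ?R1. pencil R S a) = ?T * S ^ k"
  proof (cases "odd n")
    case True
    then have "branch_points ?R1 = insert None (Some ` ?R1)" by (simp add: branch_points_def cR1)
    then show ?thesis
      using True fin by (simp add: prod.reindex k_def pencil_def mult.commute)
  next
    case False
    then show ?thesis by (simp add: branch_points_def cR1 k_def prod.reindex)
  qed
  moreover have "even (n + k)" unfolding k_def by simp
  then obtain m where m: "n + k = 2 * m" by (rule evenE)
  have S2: "(S ^ m)\<^sup>2 = S ^ n * S ^ k" by (metis m mult.commute power_add power_mult)
  have "(?q1 * S ^ m)\<^sup>2 * map_poly \<iota> f2 = ?q1\<^sup>2 * map_poly \<iota> f2 * S ^ n * S ^ k"
    unfolding power_mult_distrib S2 by (simp only: mult_ac)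
  then have "(?q1 * S ^ m)\<^sup>2 * map_poly \<iota> f2 = ?q2\<^sup>2 * smult c (?T * S ^ k)"
    unfolding W by (simp add: mult.assoc)
  moreover have "?q1 * S ^ m \<noteq> 0" using q1 S0 by (simp add: map_iota_eq_0)
  ultimately show ?thesis using that[OF RS, of "?q1 * S ^ m" ?q2 c] by simp
qed

end

section \<open>Moebius transformations of branch points\<close>

text \<open>Distinct members of the pencil share no root and each has degree at most 1, so the
  product has only simple roots, as does \<open>f\<close>. Roots of odd order are then all roots,
  and parity identifies them.\<close>

lemma roots_eq_pencil_roots:
  fixes R S f :: "'b::field poly"
  assumes deg: "degree R \<le> 1" "degree S \<le> 1" and prim: "\<forall>z. poly R z \<noteq> 0 \<or> poly S z \<noteq> 0"
    and P: "P \<noteq> 0" and f: "f \<noteq> 0" "\<And>z. poly f z = 0 \<Longrightarrow> order z f = 1"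
    and B: "finite B" and eq: "P\<^sup>2 * f = Q\<^sup>2 * smult c (\<Prod>a\<in>B. pencil R S a)"
  shows "poly f z = 0 \<longleftrightarrow> (\<exists>a\<in>B. poly (pencil R S a) z = 0)"
    and "a \<in> B \<Longrightarrow> pencil R S a \<noteq> 0"
proof -
  let ?F = "smult c (\<Prod>a\<in>B. pencil R S a)"
  have F: "?F \<noteq> 0" and par: "\<And>z. even (order z f) \<longleftrightarrow> even (order z ?F)"
    using order_parity[OF eq P f(1)] by auto
  then have c: "c \<noteq> 0" and nz: "\<And>a. a \<in> B \<Longrightarrow> pencil R S a \<noteq> 0" using B by auto
  show "a \<in> B \<Longrightarrow> pencil R S a \<noteq> 0" by (rule nz)
  show "poly f z = 0 \<longleftrightarrow> (\<exists>a\<in>B. poly (pencil R S a) z = 0)"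
  proof
    assume "poly f z = 0"
    then have "odd (order z ?F)" using f(2)[of z] par[of z] by simp
    then have "poly ?F z = 0" using order_root[of ?F z] by (auto elim: oddE)
    then show "\<exists>a\<in>B. poly (pencil R S a) z = 0" using B c by (simp add: poly_prod)
  next
    assume "\<exists>a\<in>B. poly (pencil R S a) z = 0"
    then obtain a where a: "a \<in> B" "poly (pencil R S a) z = 0" by blast
    let ?p = "\<Prod>b\<in>B - {a}. pencil R S b"
    have "poly (pencil R S b) z \<noteq> 0" if "b \<noteq> a" for b
    proof
      assume "poly (pencil R S b) z = 0"
      then have "poly S z = 0 \<and> poly R z = 0"
        using a(2) that by (cases a; cases b) (auto simp: pencil_def)
      then show False using prim by blast
    qed
    then have "poly ?p z \<noteq> 0" using B by (auto simp: poly_prod)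
    then have "order z ?p = 0" by (rule order_0I)
    moreover have "order z (pencil R S a) = 1"
    proof -
      have "degree (pencil R S a) \<le> 1"
        using deg degree_smult_le[of _ S] by (cases a) (auto simp: pencil_def intro!: degree_diff_le intro: order_trans)
      then have "order z (pencil R S a) \<le> 1"
        using order_degree[OF nz[OF a(1)], of z] by linarith
      moreover have "order z (pencil R S a) \<noteq> 0" using a nz order_root by blast
      ultimately show ?thesis by linarith
    qed
    moreover have "(\<Prod>a\<in>B. pencil R S a) = pencil R S a * ?p" using B a(1) by (rule prod.remove)
    ultimately have "order z ?F = 1"
      using F c by (simp add: order_smult order_mult)
    then have "order z f \<noteq> 0" using par[of z] by (metis even_zero odd_one)
    then show "poly f z = 0" using order_root by blast
  qed
qed

locale moebius =
  fixes \<alpha> \<beta> \<gamma> \<delta> :: "'b::field"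
  assumes det: "\<alpha> * \<delta> - \<beta> * \<gamma> \<noteq> 0"
begin

definition num :: "'b option \<Rightarrow> 'b" where
  "num p = (case p of None \<Rightarrow> \<alpha> | Some z \<Rightarrow> \<alpha> * z + \<beta>)"

definition den :: "'b option \<Rightarrow> 'b" where
  "den p = (case p of None \<Rightarrow> \<gamma> | Some z \<Rightarrow> \<gamma> * z + \<delta>)"

definition act :: "'b option \<Rightarrow> 'b option" where
  "act p = (if den p = 0 then None else Some (num p / den p))"

text \<open>The factor from the normalised coordinates \<open>(a, 1)\<close> or
  \<open>(1, 0)\<close> of \<open>act p\<close> to the image vector
  \<open>(num p, den p)\<close>.\<close>

definition scale :: "'b option \<Rightarrow> 'b" where
  "scale p = (if den p = 0 then num p else den p)"

lemma num_den_neq_0: "num p \<noteq> 0 \<or> den p \<noteq> 0"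
proof (cases p)
  case None
  then show ?thesis using det by (auto simp: num_def den_def)
next
  case (Some z)
  have "\<delta> * (\<alpha> * z + \<beta>) - \<beta> * (\<gamma> * z + \<delta>) = (\<alpha> * \<delta> - \<beta> * \<gamma>) * z"
    "\<alpha> * (\<gamma> * z + \<delta>) - \<gamma> * (\<alpha> * z + \<beta>) = \<alpha> * \<delta> - \<beta> * \<gamma>"
    by (simp_all add: algebra_simps)
  then show ?thesis using det Some by (auto simp: num_def den_def)
qed

lemma scale_neq_0: "scale p \<noteq> 0"
  using num_den_neq_0[of p] by (auto simp: scale_def)

text \<open>Multiplicativity of the determinant, corrected by the normalisation of the two image
  vectors.\<close>

lemma bracket_act: "bracket (act p) (act q) * (scale p * scale q) = (\<alpha> * \<delta> - \<beta> * \<gamma>) * bracket p q"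
proof -
  have "bracket (act p) (act q) * (scale p * scale q) = num p * den q - num q * den p"
    by (auto simp: bracket_def act_def scale_def field_simps)
  also have "\<dots> = (\<alpha> * \<delta> - \<beta> * \<gamma>) * bracket p q"
    by (cases p; cases q) (auto simp: bracket_def num_def den_def algebra_simps)
  finally show ?thesis .
qed

lemma bracket_eq_0_iff: "bracket p q = 0 \<longleftrightarrow> p = (q :: 'b option)"
  by (cases p; cases q) (auto simp: bracket_def)

lemma inj_act: "inj act"
proof (rule injI)
  fix p q assume "act p = act q"
  then have "bracket (act p) (act q) = 0" by (simp add: bracket_eq_0_iff)
  then have "(\<alpha> * \<delta> - \<beta> * \<gamma>) * bracket p q = 0" using bracket_act[of p q] by simp
  then show "p = q" using det by (simp add: bracket_eq_0_iff)
qed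

lemma act_eq_iff: "act p = t \<longleftrightarrow>
    (case t of None \<Rightarrow> den p = 0 | Some a \<Rightarrow> num p - a * den p = 0)"
  using num_den_neq_0[of p] by (cases t) (auto simp: act_def field_simps)

lemma num_None_den_None: "num None - a * den None = \<alpha> - a * \<gamma>"
  by (simp add: num_def den_def)

lemma surj_act: "surj act"
proof (rule surjI)
  fix t
  \<comment> \<open>The witness is the inverse transformation, with rows
    \<open>(\<delta>, - \<beta>)\<close> and \<open>(- \<gamma>, \<alpha>)\<close>, applied to
    \<open>t\<close>.\<close>
  show "act (case t of None \<Rightarrow> if \<gamma> = 0 then None else Some (- \<delta> / \<gamma>)
      | Some a \<Rightarrow> if \<alpha> - a * \<gamma> = 0 then None else Some ((a * \<delta> - \<beta>) / (\<alpha> - a * \<gamma>))) = t"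
    (is "act ?p = t")
  proof -
    have "case t of None \<Rightarrow> den ?p = 0 | Some a \<Rightarrow> num ?p - a * den ?p = 0"
    proof (cases t)
      case (Some a)
      have *: "num (Some y) - a * den (Some y) = (\<alpha> - a * \<gamma>) * y - (a * \<delta> - \<beta>)" for y
        by (simp add: num_def den_def algebra_simps)
      have "k * (b / k) - b = 0" if "k \<noteq> 0" for k b :: 'b using that by simp
      then show ?thesis
        using Some *[of "(a * \<delta> - \<beta>) / (\<alpha> - a * \<gamma>)"]
          num_None_den_None[of a]
        by (cases "\<alpha> - a * \<gamma> = 0") (simp_all only: option.case refl if_True if_False)
    qed (simp add: den_def)
    then show ?thesis using act_eq_iff[of ?p t] by (cases t) auto
  qed
qed

lemma pencil_root_iff_act: "poly (pencil [:\<beta>, \<alpha>:] [:\<delta>, \<gamma>:] a) z = 0 \<longleftrightarrow> act (Some z) = a"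
  using act_eq_iff[of "Some z" a] by (cases a) (auto simp: pencil_def num_def den_def algebra_simps)

text \<open>The valuation of the determinant is split evenly between \<open>p\<close> and
  \<open>q\<close>, so that the change is a sum of one function at the two points.\<close>

lemma valuation_bracket_act:
  assumes v: "is_valuation v" and "p \<noteq> q"
  shows "v (bracket (act p) (act q)) = v (bracket p q)
    - (v (scale p) - v (\<alpha> * \<delta> - \<beta> * \<gamma>) / 2) - (v (scale q) - v (\<alpha> * \<delta> - \<beta> * \<gamma>) / 2)"
proof -
  have mult: "v (a * b) = v a + v b" if "a \<noteq> 0" "b \<noteq> 0" for a b
    using v that unfolding is_valuation_def by blast
  have nz: "bracket p q \<noteq> 0" "bracket (act p) (act q) \<noteq> 0"
    using assms(2) inj_act by (auto simp: bracket_eq_0_iff inj_eq)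
  have "v (bracket (act p) (act q)) + (v (scale p) + v (scale q)) = v (\<alpha> * \<delta> - \<beta> * \<gamma>) + v (bracket p q)"
    using arg_cong[OF bracket_act[of p q], of v] nz det scale_neq_0[of p] scale_neq_0[of q]
    by (simp add: mult)
  then show ?thesis by linarith
qed

text \<open>Branch sets have even cardinality, so the finite branch points determine whether infinity is one.\<close>

lemma bij_betw_act_branch_points:
  assumes fin: "finite R1" "finite R2" and R2: "\<And>z. z \<in> R2 \<longleftrightarrow> act (Some z) \<in> branch_points R1"
  shows "bij_betw act (branch_points R2) (branch_points R1)"
proof -
  have im: "act ` Some ` R2 = branch_points R1 - {act None}"
  proof (intro equalityI subsetI)
    fix t assume "t \<in> act ` Some ` R2"
    then show "t \<in> branch_points R1 - {act None}" using R2 inj_act by (auto simp: inj_eq)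
  next
    fix t assume t: "t \<in> branch_points R1 - {act None}"
    obtain p where p: "t = act p" using surj_act by blast
    then obtain z where "p = Some z" using t by (cases p) auto
    then show "t \<in> act ` Some ` R2" using t p R2 by auto
  qed
  have inj: "inj_on act A" for A using inj_act by (rule inj_on_subset) simp
  have "card R2 = card (branch_points R1 - {act None})"
    unfolding im[symmetric] card_image[OF inj] by (simp add: card_image)
  moreover have "finite (branch_points R1)" using fin by (simp add: branch_points_def)
  ultimately have "card R2 = card (branch_points R1) - (if act None \<in> branch_points R1 then 1 else 0)"
    by (simp add: card_Diff_singleton)
  moreover have "card (branch_points R1) > 0" if "act None \<in> branch_points R1"
    using that \<open>finite (branch_points R1)\<close> by (auto simp: card_gt_0_iff)
  ultimately have par: "odd (card R2) \<longleftrightarrow> act None \<in> branch_points R1"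
    using even_card_branch_points[OF fin(1)] by (auto split: if_splits)
  have "act ` branch_points R2 = branch_points R1"
  proof (cases "odd (card R2)")
    case True
    then have "act ` branch_points R2 = insert (act None) (branch_points R1 - {act None})"
      unfolding branch_points_def[of R2] image_Un im by simp
    then show ?thesis using par True by (simp add: insert_absorb)
  next
    case False
    then have "act ` branch_points R2 = branch_points R1 - {act None}"
      unfolding branch_points_def[of R2] image_Un im by simp
    then show ?thesis using par False by simp
  qed
  then show ?thesis by (simp add: bij_betw_def inj)
qed

end

lemma equivalent_cpic_sym: "equivalent_cpic P Q \<Longrightarrow> equivalent_cpic Q P"
  unfolding equivalent_cpic_def by blast

text \<open>The image of \<open>x\<close> is a function on the second curve, so the Moebius map
  carries the branch points of \<open>f2\<close> to those of \<open>f1\<close>. The chain of steps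
  starts at \<open>f2\<close>, and symmetry of the equivalence reverses it.\<close>

lemma (in embedded_function_field_iso) equivalent_root_pictures:
  assumes v: "is_valuation v" and deg1: "degree f1 \<ge> 2"
  shows "equivalent_cpic (weight_pic (roots_of \<iota> f1) (\<lambda>x y. v (x - y))) (weight_pic (roots_of \<iota> f2) (\<lambda>x y. v (x - y)))"
proof -
  let ?R1 = "roots_of \<iota> f1" and ?R2 = "roots_of \<iota> f2"
  have fin: "finite ?R1" "finite ?R2"
    unfolding roots_of_def using separable_map_iota(1) sep1 sep2 poly_roots_finite by blast+
  have pr: "proper ?R1" "proper ?R2"
    using card_roots_of[OF sep1] card_roots_of[OF sep2] deg1 deg5 unfolding proper_def by auto
  obtain R S P Q c where RS: "degree R \<le> 1" "degree S \<le> 1" "\<forall>z. poly R z \<noteq> 0 \<or> poly S z \<noteq> 0" "P \<noteq> 0"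
    "P\<^sup>2 * map_poly \<iota> f2 = Q\<^sup>2 * smult c (\<Prod>a\<in>branch_points ?R1. pencil R S a)"
    by (rule branch_identity)
  have finB: "finite (branch_points ?R1)" using fin by (simp add: branch_points_def)
  note sf2 = separable_map_iota[OF sep2]
  have roots: "\<And>z. poly (map_poly \<iota> f2) z = 0 \<longleftrightarrow> (\<exists>a\<in>branch_points ?R1. poly (pencil R S a) z = 0)"
    "\<And>a. a \<in> branch_points ?R1 \<Longrightarrow> pencil R S a \<noteq> 0"
    using roots_eq_pencil_roots[OF RS(1-4) sf2(1) sf2(2) finB RS(5)] by blast+
  obtain \<alpha> \<beta> where R: "R = [:\<beta>, \<alpha>:]" using RS(1) by (cases R rule: pCons_cases) (auto elim!: degree_eq_zeroE split: if_splits)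
  obtain \<gamma> \<delta> where S: "S = [:\<delta>, \<gamma>:]" using RS(2) by (cases S rule: pCons_cases) (auto elim!: degree_eq_zeroE split: if_splits)
  have "?R2 \<noteq> {}" using pr(2) unfolding proper_def by auto
  then obtain z where "poly (map_poly \<iota> f2) z = 0" unfolding roots_of_def by auto
  then obtain a where a: "a \<in> branch_points ?R1" "poly (pencil R S a) z = 0" using roots(1) by blast
  \<comment> \<open>Otherwise all pencil members are constant, and the one that vanishes at a root
    of \<open>f2\<close> would be the zero polynomial.\<close>
  have "\<alpha> \<noteq> 0 \<or> \<gamma> \<noteq> 0"
  proof (rule ccontr)
    assume "\<not> ?thesis"
    then have "pencil R S a = 0" using a(2) by (cases a) (auto simp: pencil_def R S)
    then show False using roots(2)[OF a(1)] by simp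
  qed
  \<comment> \<open>At the root \<open>- \<beta> / \<alpha>\<close> of \<open>R\<close> the value of
    \<open>S\<close> is the determinant over \<alpha>; at the root of \<open>S\<close> the value of
    \<open>R\<close> is, up to sign, the determinant over \<gamma>. A zero determinant would thus
    give a common root.\<close>
  then have det: "\<alpha> * \<delta> - \<beta> * \<gamma> \<noteq> 0"
  proof (elim disjE)
    assume "\<alpha> \<noteq> 0"
    then show ?thesis using RS(3)[rule_format, of "- \<beta> / \<alpha>"] by (auto simp: R S field_simps)
  next
    assume "\<gamma> \<noteq> 0"
    then show ?thesis using RS(3)[rule_format, of "- \<delta> / \<gamma>"] by (auto simp: R S field_simps)
  qed
  interpret moebius \<alpha> \<beta> \<gamma> \<delta> by unfold_locales (rule det)
  have "bij_betw act (branch_points ?R2) (branch_points ?R1)"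
  proof (rule bij_betw_act_branch_points[OF fin])
    show "z \<in> ?R2 \<longleftrightarrow> act (Some z) \<in> branch_points ?R1" for z
      using roots(1)[of z] by (auto simp: roots_of_def R S pencil_root_iff_act)
  qed
  from equivalent_of_bracket_twist[OF v inf fin(2) pr(2) fin(1) pr(1) this valuation_bracket_act[OF v]]
  show ?thesis by (rule equivalent_cpic_sym)
qed

theorem theorem14p4:
  fixes \<iota> :: "'a::field \<Rightarrow> 'b::field" and v :: "'b \<Rightarrow> rat" and f1 f2 :: "'a poly"
  assumes "local_field_setup \<iota> v"
    and "hyperelliptic_poly \<iota> f1" and "hyperelliptic_poly \<iota> f2"
    and "curves_iso_over_K f1 f2"
  shows "equivalent_cpic (curve_cluster_picture \<iota> v f1) (curve_cluster_picture \<iota> v f2)"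
proof -
  have v: "is_valuation v" and emb: "field_embedding \<iota>" and two: "(2::'a) \<noteq> 0"
    and closed: "\<And>p :: 'b poly. degree p \<ge> 1 \<Longrightarrow> \<exists>z. poly p z = 0"
    and vals: "(\<lambda>a. v (\<iota> a)) ` (UNIV - {0}) = range of_int"
    using assms(1) unfolding local_field_setup_def algebraic_closure_of_def by auto
  \<comment> \<open>The closure is infinite because the valuation takes every integer value on
    it.\<close>
  have "infinite (range (of_int :: int \<Rightarrow> rat))"
    using finite_imageD[of "of_int :: int \<Rightarrow> rat" UNIV] infinite_UNIV_int by (auto simp: inj_on_def)
  moreover have "range of_int \<subseteq> range v" unfolding vals[symmetric] by auto
  ultimately have inf: "infinite (UNIV :: 'b set)" using finite_subset finite_imageI by metis
  obtain \<phi> :: "'a ffield \<Rightarrow> 'a ffield" where \<phi>: "function_field_iso f1 f2 \<phi>"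
    using assms(4) two unfolding curves_iso_over_K_def function_field_iso_def by blast
  have sep: "separable_poly \<iota> f1" "separable_poly \<iota> f2" and deg: "degree f1 \<ge> 5" "degree f2 \<ge> 5"
    using assms(2,3) unfolding hyperelliptic_poly_def by auto
  interpret embedded_function_field_iso f1 f2 \<phi> \<iota>
    using \<phi> closed inf emb sep deg(2)
    by (simp add: embedded_function_field_iso_def embedded_function_field_iso_axioms_def)
  have "finite (roots_of \<iota> f)" if "separable_poly \<iota> f" for f
    unfolding roots_of_def using separable_map_iota(1)[OF that] by (rule poly_roots_finite)
  then show ?thesis
    using equivalent_root_pictures[OF v] deg sep by (simp add: curve_cluster_picture_eq[OF v])
qed

end
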